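(* Let $\mathcal{A}$ and $\mathcal{B}$ be unital $C^*$-algebras and $\phi:\mathcal{A}\to\mathcal{B}$ a positive unital linear map. Let $\mathcal{E}:\mathcal{B}\to\mathcal{C}$ be a conditional expectation from $\mathcal{B}$ onto a $C^*$-subalgebra $\mathcal{C}$. Let $f:I\to\mathbb{R}$ be a convex function defined on some open interval $I\subseteq\mathbb{R}$, let $a\in\mathcal{A}$ be self-adjoint with $\sigma(a)\subseteq I$ and such that $\phi(a)$ belongs to the centralizer $\mathcal{B}^{\mathcal{E}}$, and let $g:J\to\mathbb{R}$ be any increasing convex function defined on some open interval $J$ with $\mathrm{Im}(f)\subseteq J$. Then $$\mathcal{E}\big(g[f(\phi(a))]\big)\leq\mathcal{E}\big(g[\phi(f(a))]\big).$$
   Context: A linear map between $C^*$-algebras is positive if it maps positive elements to positive elements. $\sigma(a)$ is the spectrum of $a$; functions of self-adjoint elements are defined by continuous functional calculus. Let $\mathcal{C}\subseteq\mathcal{B}$ be $C^*$-algebras. A conditional expectation $\mathcal{E}:\mathcal{B}\to\mathcal{C}$ is a positive $\mathcal{C}$-linear projection from $\mathcal{B}$ onto $\mathcal{C}$ of norm $1$. The centralizer of $\mathcal{E}$ is the $C^*$-subalgebra $$\mathcal{B}^{\mathcal{E}}=\{b\in\mathcal{B}:\ \mathcal{E}(bx)=\mathcal{E}(xb)\ \text{for all } x\in\mathcal{B}\}.$$ *)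

theory Defs
  imports "HOL-Analysis.Analysis"
begin

section \<open>Unital C*-algebras\<close>

text \<open>The zero algebra is excluded, since \<open>real_normed_algebra_1\<close> postulates \<open>norm 1 = 1\<close>.\<close>

class unital_cstar_algebra = real_normed_algebra_1 + banach +
  fixes scaleC :: "complex \<Rightarrow> 'a \<Rightarrow> 'a"  (infixr \<open>*\<^sub>C\<close> 75)
    and star :: "'a \<Rightarrow> 'a"
  assumes scaleC_add_right: "c *\<^sub>C (x + y) = c *\<^sub>C x + c *\<^sub>C y"
    and scaleC_add_left: "(c + d) *\<^sub>C x = c *\<^sub>C x + d *\<^sub>C x"
    and scaleC_scaleC: "c *\<^sub>C d *\<^sub>C x = (c * d) *\<^sub>C x"
    and scaleC_one: "1 *\<^sub>C x = x"
    and scaleR_scaleC: "r *\<^sub>R x = complex_of_real r *\<^sub>C x"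
    and mult_scaleC_left: "(c *\<^sub>C x) * y = c *\<^sub>C (x * y)"
    and mult_scaleC_right: "x * (c *\<^sub>C y) = c *\<^sub>C (x * y)"
    and norm_scaleC: "norm (c *\<^sub>C x) = cmod c * norm x"
    and star_star: "star (star x) = x"
    and star_add: "star (x + y) = star x + star y"
    and star_scaleC: "star (c *\<^sub>C x) = cnj c *\<^sub>C star x"
    and star_mult: "star (x * y) = star y * star x"
    and norm_star_mult_self: "norm (star x * x) = (norm x)\<^sup>2"

lemma vector_space_scaleC:
  "vector_space (scaleC :: complex \<Rightarrow> 'a::unital_cstar_algebra \<Rightarrow> 'a)"
  by unfold_locales (simp_all add: scaleC_add_right scaleC_add_left scaleC_scaleC scaleC_one)

abbreviation clinear :: "('a::unital_cstar_algebra \<Rightarrow> 'b::unital_cstar_algebra) \<Rightarrow> bool"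
  where "clinear \<equiv> Vector_Spaces.linear scaleC scaleC"

abbreviation csubspace :: "'a::unital_cstar_algebra set \<Rightarrow> bool"
  where "csubspace \<equiv> module.subspace scaleC"

text \<open>A C*-subalgebra need not contain the unit of the ambient algebra.\<close>

definition cstar_subalgebra :: "'a::unital_cstar_algebra set \<Rightarrow> bool"
  where "cstar_subalgebra S \<longleftrightarrow>
    csubspace S \<and> (\<forall>x\<in>S. \<forall>y\<in>S. x * y \<in> S) \<and> (\<forall>x\<in>S. star x \<in> S) \<and> closed S"

section \<open>Spectrum, order and functional calculus\<close>

definition spectrum :: "'a::unital_cstar_algebra \<Rightarrow> complex set"
  where "spectrum a =
    {l. \<not> (\<exists>b. b * (l *\<^sub>C 1 - a) = 1 \<and> (l *\<^sub>C 1 - a) * b = 1)}"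

definition self_adjoint :: "'a::unital_cstar_algebra \<Rightarrow> bool"
  where "self_adjoint a \<longleftrightarrow> star a = a"

definition positive :: "'a::unital_cstar_algebra \<Rightarrow> bool"
  where "positive a \<longleftrightarrow> self_adjoint a \<and> spectrum a \<subseteq> complex_of_real ` {0..}"

definition cstar_le :: "'a::unital_cstar_algebra \<Rightarrow> 'a \<Rightarrow> bool"  (infix \<open>\<preceq>\<close> 50)
  where "a \<preceq> b \<longleftrightarrow> positive (b - a)"

text \<open>
  \<open>functional_calculus_hom a \<Phi>\<close> says that \<open>\<Phi>\<close> induces a unital *-homomorphism from the continuous
  complex functions on the spectrum of \<open>a\<close> into the algebra that maps the identity function to \<open>a\<close>.
  Such functions are represented by total functions that are continuous on the spectrum; by the
  first condition \<open>\<Phi>\<close> depends only on their restrictions to it. The values of \<open>\<Phi>\<close> at other functions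
  are unconstrained.
\<close>

definition functional_calculus_hom ::
    "'a::unital_cstar_algebra \<Rightarrow> ((complex \<Rightarrow> complex) \<Rightarrow> 'a) \<Rightarrow> bool"
  where "functional_calculus_hom a \<Phi> \<longleftrightarrow>
    (\<forall>h k. continuous_on (spectrum a) h \<longrightarrow> continuous_on (spectrum a) k \<longrightarrow>
       ((\<forall>z\<in>spectrum a. h z = k z) \<longrightarrow> \<Phi> h = \<Phi> k) \<and>
       \<Phi> (\<lambda>z. h z + k z) = \<Phi> h + \<Phi> k \<and>
       \<Phi> (\<lambda>z. h z * k z) = \<Phi> h * \<Phi> k) \<and>
    (\<forall>c h. continuous_on (spectrum a) h \<longrightarrow> \<Phi> (\<lambda>z. c * h z) = c *\<^sub>C \<Phi> h) \<and>
    (\<forall>h. continuous_on (spectrum a) h \<longrightarrow> \<Phi> (\<lambda>z. cnj (h z)) = star (\<Phi> h)) \<and>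
    \<Phi> (\<lambda>z. 1) = 1 \<and>
    \<Phi> (\<lambda>z. z) = a"

text \<open>
  \<open>cfc f a\<close> is \<open>f(a)\<close>. It is meaningful for self-adjoint \<open>a\<close> (whose spectrum is real) and \<open>f\<close>
  continuous on the spectrum of \<open>a\<close>.
\<close>

definition cfc :: "(real \<Rightarrow> real) \<Rightarrow> 'a::unital_cstar_algebra \<Rightarrow> 'a"
  where "cfc f a =
    (THE b. \<exists>\<Phi>. functional_calculus_hom a \<Phi> \<and> b = \<Phi> (\<lambda>z. complex_of_real (f (Re z))))"

section \<open>Positive maps and conditional expectations\<close>

definition positive_map :: "('a::unital_cstar_algebra \<Rightarrow> 'b::unital_cstar_algebra) \<Rightarrow> bool"
  where "positive_map \<phi> \<longleftrightarrow> clinear \<phi> \<and> (\<forall>x. positive x \<longrightarrow> positive (\<phi> x))"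

text \<open>
  The expectation onto \<open>C\<close> is a self-map of the ambient algebra with range \<open>C\<close>. Boundedness is
  required separately because \<open>onorm\<close> is a supremum of reals, unspecified for unbounded sets.
\<close>

definition conditional_expectation ::
    "('b::unital_cstar_algebra \<Rightarrow> 'b) \<Rightarrow> 'b set \<Rightarrow> bool"
  where "conditional_expectation E C \<longleftrightarrow>
    positive_map E \<and>
    (\<forall>c\<in>C. \<forall>x. E (c * x) = c * E x \<and> E (x * c) = E x * c) \<and>
    range E = C \<and> (\<forall>c\<in>C. E c = c) \<and>
    bounded_linear E \<and> onorm E = 1"

definition centralizer :: "('b::unital_cstar_algebra \<Rightarrow> 'b) \<Rightarrow> 'b set"
  where "centralizer E = {b. \<forall>x. E (b * x) = E (x * b)}"

end

theory Submission
  imports Defs "HOL-Computational_Algebra.Fundamental_Theorem_Algebra"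
begin

text \<open>Put \<open>b = \<phi> a\<close>, \<open>y = \<phi> (f a)\<close> and \<open>x = g y\<close>. For each \<open>t \<in> I\<close>, take a supporting line of \<open>f\<close> at \<open>t\<close> and
one of \<open>g\<close> at \<open>f t\<close>; the latter has nonnegative slope because \<open>g\<close> is increasing. Applying the first to
\<open>a\<close> and then \<open>\<phi>\<close>, and the second to \<open>y\<close>, gives an affine function \<open>l\<^sub>t\<close> with \<open>l\<^sub>t(t) = g(f t)\<close> and
\<open>l\<^sub>t(b) \<le> x\<close>. It remains to pass from these affine minorants to \<open>E(g(f(b))) \<le> E x\<close>, and this is where the
centralizer enters.

The functions of \<open>b\<close> lie in the centralizer. So for \<open>w \<ge> 0\<close> continuous on the spectrum of \<open>b\<close>, with square
root \<open>k\<close>, and for \<open>z \<ge> 0\<close>, one has \<open>E(w(b) z) = E(k(b) z k(b)) \<ge> 0\<close> (\<open>positive_weighted_expectation\<close>).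
Given \<open>e > 0\<close>, choose a finite partition of unity \<open>w\<^sub>t\<close> on the spectrum such that \<open>l\<^sub>t \<ge> g \<circ> f - e\<close> wherever
\<open>w\<^sub>t \<noteq> 0\<close>. Then \<open>E x = \<Sum> E(w\<^sub>t(b) x) \<ge> \<Sum> E(w\<^sub>t(b) l\<^sub>t(b)) \<ge> E(g(f(b))) - e E 1\<close>
(\<open>expectation_ge_cfc\<close>), and \<open>e \<rightarrow> 0\<close> finishes the proof, since the positive cone is closed.

The supporting C*-algebra theory is kept elementary. A self-adjoint element attains its norm on its
spectrum (\<open>norm_attained_in_spectrum\<close>); together with factorization of complex polynomials this bounds
\<open>p(a)\<close> by the supremum of \<open>\<bar>p\<bar>\<close> on the spectrum, and the Weierstrass theorem then gives the continuous
functional calculus. The inequality \<open>k(b) z k(b) \<ge> 0\<close> is proved for \<open>k > 0\<close>, when \<open>k(b)\<close> is invertible, and the weight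
\<open>w \<ge> 0\<close> is approximated by \<open>w + e\<close>; so the positivity of \<open>u\<^sup>* u\<close> for general \<open>u\<close> is not required.\<close>

section \<open>Invertible elements\<close>

interpretation cvs: vector_space "scaleC :: complex \<Rightarrow> 'a::unital_cstar_algebra \<Rightarrow> 'a"
  by (rule vector_space_scaleC)

text \<open>Two-sided invertibility in a ring or monoid; \<open>l\<close> is in the spectrum of \<open>a\<close> iff \<open>l - a\<close> fails to have an inverse.\<close>

definition has_inverse :: "'a::monoid_mult \<Rightarrow> bool"
  where "has_inverse x \<longleftrightarrow> (\<exists>y. y * x = 1 \<and> x * y = 1)"

lemma has_inverseI: "y * x = 1 \<Longrightarrow> x * y = 1 \<Longrightarrow> has_inverse x"
  by (auto simp: has_inverse_def)

lemma has_inverse_mult: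
  assumes "has_inverse x" "has_inverse y"
  shows "has_inverse (x * y)"
proof -
  obtain u v where u: "u * x = 1" "x * u = 1" and v: "v * y = 1" "y * v = 1"
    using assms by (auto simp: has_inverse_def)
  have "(v * u) * (x * y) = v * (u * x) * y" "(x * y) * (v * u) = x * (y * v) * u"
    by (simp_all only: mult.assoc)
  with u v show ?thesis by (intro has_inverseI) simp_all
qed

lemma spectrum_iff: "l \<in> spectrum a \<longleftrightarrow> \<not> has_inverse (l *\<^sub>C 1 - a)"
  by (simp add: spectrum_def has_inverse_def)

lemma has_inverse_scaleC:
  fixes x :: "'a::unital_cstar_algebra"
  assumes "has_inverse x" "c \<noteq> 0"
  shows "has_inverse (c *\<^sub>C x)"
proof -
  obtain y where y: "y * x = 1" "x * y = 1"
    using assms by (auto simp: has_inverse_def)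
  show ?thesis
    by (rule has_inverseI[of "inverse c *\<^sub>C y"])
       (use y assms in \<open>simp_all add: mult_scaleC_left mult_scaleC_right scaleC_scaleC scaleC_one\<close>)
qed

lemma has_inverse_uminus:
  fixes x :: "'a::ring_1"
  assumes "has_inverse x"
  shows "has_inverse (- x)"
proof -
  obtain y where y: "y * x = 1" "x * y = 1"
    using assms by (auto simp: has_inverse_def)
  show ?thesis
    by (rule has_inverseI[of "- y"]) (use y in simp_all)
qed

lemma has_inverse_one_minus:
  fixes x :: "'a::{real_normed_algebra_1,banach}"
  assumes "norm x < 1"
  shows "has_inverse (1 - x)"
proof -
  have s: "summable (\<lambda>n. x ^ n)"
    by (rule complete_algebra_summable_geometric[OF assms])
  define y where "y = (\<Sum>n. x ^ n)"
  have "y = 1 + (\<Sum>n. x ^ Suc n)"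
    using suminf_split_head[OF s] by (simp add: y_def)
  moreover have "(\<Sum>n. x ^ Suc n) = x * y"
    using suminf_mult[OF s, of x] by (simp add: y_def)
  moreover have "(\<Sum>n. x ^ Suc n) = y * x"
    using suminf_mult2[OF s, of x] by (simp add: y_def power_commutes)
  ultimately show ?thesis
    by (intro has_inverseI[of y]) (simp_all add: algebra_simps)
qed

text \<open>Stability of invertibility, with a quantitative bound on the change of the inverse.\<close>

lemma inverse_perturb:
  fixes u v d :: "'a::{real_normed_algebra_1,banach}"
  assumes uv: "u * v = 1" "v * u = 1" and M: "norm u \<le> M" and d: "M * norm d \<le> 1/2"
  obtains w where "w * (v + d) = 1" "(v + d) * w = 1" "norm (w - u) \<le> 2 * M\<^sup>2 * norm d"
proof -
  have M0: "0 \<le> M" using M norm_ge_zero order_trans by blast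
  have "norm (- (u * d)) \<le> norm u * norm d" by (simp add: norm_mult_ineq)
  also have "\<dots> \<le> M * norm d" by (rule mult_right_mono) (use M in simp_all)
  finally have "norm (- (u * d)) < 1" using d by linarith
  then have "has_inverse (1 - - (u * d))" by (rule has_inverse_one_minus)
  moreover have "has_inverse v" using uv by (auto simp: has_inverse_def)
  ultimately have "has_inverse (v * (1 - - (u * d)))" by (intro has_inverse_mult)
  moreover have "v * (1 - - (u * d)) = v + d"
    using uv by (simp add: distrib_left mult.assoc[symmetric])
  ultimately obtain w where w: "w * (v + d) = 1" "(v + d) * w = 1"
    by (auto simp: has_inverse_def)
  have "u * ((v + d) * w) = w + u * d * w"
    using uv by (simp add: distrib_left distrib_right mult.assoc[symmetric])
  then have eq: "w - u = - (u * d * w)" using w by (simp add: eq_neg_iff_add_eq_0 diff_add_eq)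
  have nd: "norm (w - u) \<le> M * norm d * norm w"
  proof -
    have "norm (w - u) \<le> norm u * norm d * norm w"
      unfolding eq norm_minus_cancel
      by (meson mult_right_mono norm_ge_zero norm_mult_ineq order_trans)
    also have "\<dots> \<le> M * norm d * norm w"
      using M by (intro mult_right_mono) simp_all
    finally show ?thesis .
  qed
  have "norm w \<le> norm u + norm (w - u)" using norm_triangle_sub by blast
  also have "\<dots> \<le> M + 1/2 * norm w"
    using nd M mult_right_mono[OF d, of "norm w"] by simp
  finally have "norm w \<le> 2 * M" by simp
  then have "M * norm d * norm w \<le> M * norm d * (2 * M)"
    using M0 by (intro mult_left_mono) simp_all
  with nd have "norm (w - u) \<le> 2 * M\<^sup>2 * norm d" by (simp add: power2_eq_square algebra_simps)
  with w show ?thesis by (rule that)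
qed

section \<open>The norm of a self-adjoint element lies in its spectrum up to phase\<close>

text \<open>The identity \<open>(1 - z\<^sup>2)\<^sup>-\<^sup>1 = 1/2 ((1 - z)\<^sup>-\<^sup>1 + (1 + z)\<^sup>-\<^sup>1)\<close> shows that a bound on the difference of two
resolvents, uniform over the unit circle, is inherited by the squares of the two elements.\<close>

lemma doubling_step:
  fixes x y :: "'a::unital_cstar_algebra"
  assumes "\<And>l. cmod l = 1 \<Longrightarrow> \<exists>u v. u * (1 - l *\<^sub>C x) = 1 \<and> (1 - l *\<^sub>C x) * u = 1 \<and>
      v * (1 - l *\<^sub>C y) = 1 \<and> (1 - l *\<^sub>C y) * v = 1 \<and> norm (u - v) \<le> e"
    and l: "cmod l = 1"
  shows "\<exists>u v. u * (1 - l *\<^sub>C x\<^sup>2) = 1 \<and> (1 - l *\<^sub>C x\<^sup>2) * u = 1 \<and>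
      v * (1 - l *\<^sub>C y\<^sup>2) = 1 \<and> (1 - l *\<^sub>C y\<^sup>2) * v = 1 \<and> norm (u - v) \<le> e"
proof -
  have half: "((1/2) *\<^sub>R (u1 + u2)) * (1 - l *\<^sub>C z\<^sup>2) = 1 \<and> (1 - l *\<^sub>C z\<^sup>2) * ((1/2) *\<^sub>R (u1 + u2)) = 1"
    if u: "u1 * (1 - m *\<^sub>C z) = 1" "(1 - m *\<^sub>C z) * u1 = 1" "u2 * (1 + m *\<^sub>C z) = 1" "(1 + m *\<^sub>C z) * u2 = 1"
      and m: "m\<^sup>2 = l" for u1 u2 z :: 'a and m
  proof -
    have f: "1 - l *\<^sub>C z\<^sup>2 = (1 - m *\<^sub>C z) * (1 + m *\<^sub>C z)" "1 - l *\<^sub>C z\<^sup>2 = (1 + m *\<^sub>C z) * (1 - m *\<^sub>C z)"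
      by (simp_all add: m[symmetric] algebra_simps mult_scaleC_left mult_scaleC_right scaleC_scaleC power2_eq_square)
    have "u1 * (1 - l *\<^sub>C z\<^sup>2) = 1 + m *\<^sub>C z" "(1 - l *\<^sub>C z\<^sup>2) * u2 = 1 - m *\<^sub>C z"
      unfolding f(1) using u(1,4) by (simp_all only: mult.assoc[symmetric] mult_1_left) (simp only: mult.assoc mult_1_right)
    moreover have "u2 * (1 - l *\<^sub>C z\<^sup>2) = 1 - m *\<^sub>C z" "(1 - l *\<^sub>C z\<^sup>2) * u1 = 1 + m *\<^sub>C z"
      unfolding f(2) using u(3,2) by (simp_all only: mult.assoc[symmetric] mult_1_left) (simp only: mult.assoc mult_1_right)
    moreover have "(1/2) *\<^sub>R (1 + m *\<^sub>C z + (1 - m *\<^sub>C z)) = 1"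
      by (simp add: scaleR_2[symmetric])
    ultimately show ?thesis
      by (simp add: distrib_left distrib_right add.commute)
  qed
  \<comment> \<open>a factorization \<open>1 - l z\<^sup>2 = (1 - m z) (1 + m z)\<close> with \<open>m\<close> on the circle again\<close>
  define m where "m = csqrt l"
  have m2: "m\<^sup>2 = l" by (simp add: m_def)
  then have m: "cmod m = 1" "cmod (- m) = 1"
    using l by (simp_all add: m_def)
  obtain u1 v1 where 1: "u1 * (1 - m *\<^sub>C x) = 1 \<and> (1 - m *\<^sub>C x) * u1 = 1 \<and>
      v1 * (1 - m *\<^sub>C y) = 1 \<and> (1 - m *\<^sub>C y) * v1 = 1 \<and> norm (u1 - v1) \<le> e"
    using assms(1)[OF m(1)] by blast
  obtain u2 v2 where 2: "u2 * (1 + m *\<^sub>C x) = 1 \<and> (1 + m *\<^sub>C x) * u2 = 1 \<and>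
      v2 * (1 + m *\<^sub>C y) = 1 \<and> (1 + m *\<^sub>C y) * v2 = 1 \<and> norm (u2 - v2) \<le> e"
    using assms(1)[OF m(2)] by auto
  have "norm ((1/2) *\<^sub>R (u1 + u2) - (1/2) *\<^sub>R (v1 + v2)) = 1/2 * norm ((u1 - v1) + (u2 - v2))"
    using norm_scaleR[of "1/2" "(u1 - v1) + (u2 - v2)"] by (simp add: scaleR_add_right scaleR_diff_right algebra_simps)
  also have "\<dots> \<le> 1/2 * (norm (u1 - v1) + norm (u2 - v2))"
    using norm_triangle_ineq by (simp add: mult_left_mono)
  also have "\<dots> \<le> e" using 1 2 by simp
  finally show ?thesis
    using half[of u1 m x u2] half[of v1 m y v2] 1 2 m2 by blast
qed

lemma has_inverse_bound_on_circle:
  fixes a :: "'a::unital_cstar_algebra"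
  assumes "\<And>l. cmod l = 1 \<Longrightarrow> has_inverse (1 - l *\<^sub>C a)"
  obtains M where "0 < M" "\<And>l. cmod l = 1 \<Longrightarrow>
    \<exists>u. u * (1 - l *\<^sub>C a) = 1 \<and> (1 - l *\<^sub>C a) * u = 1 \<and> norm u \<le> M"
proof -
  let ?P = "\<lambda>l M. \<exists>u. u * (1 - l *\<^sub>C a) = 1 \<and> (1 - l *\<^sub>C a) * u = 1 \<and> norm u \<le> M"
  have loc: "\<exists>r M. 0 < r \<and> (\<forall>k\<in>ball l r. ?P k M)" if l: "cmod l = 1" for l
  proof -
    obtain u where u: "u * (1 - l *\<^sub>C a) = 1" "(1 - l *\<^sub>C a) * u = 1"
      using assms[OF l] by (auto simp: has_inverse_def)
    define M where "M = norm u + 1"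
    define r where "r = 1 / (2 * M * (norm a + 1))"
    have M: "M > 0" by (simp add: M_def add_nonneg_pos)
    have na: "norm a + 1 > 0" by (simp add: add_nonneg_pos)
    have r: "r > 0" using M na by (simp add: r_def)
    have "?P k (norm u + M)" if k: "k \<in> ball l r" for k
    proof -
      define d where "d = (l - k) *\<^sub>C a"
      have nd: "norm d \<le> r * (norm a + 1)"
        unfolding d_def norm_scaleC using k r by (intro mult_mono) (auto simp: dist_norm)
      have "M * norm d \<le> M * (r * (norm a + 1))" using nd M by simp
      also have "\<dots> = 1/2"
      proof -
        have "M * (1 / (2 * M * N) * N) = 1/2" if "N > 0" for N using M that by simp
        from this[OF na] show ?thesis by (simp only: r_def)
      qed
      finally have Md: "M * norm d \<le> 1/2" .
      obtain w where w: "w * (1 - l *\<^sub>C a + d) = 1" "(1 - l *\<^sub>C a + d) * w = 1" "norm (w - u) \<le> 2 * M\<^sup>2 * norm d"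
        using inverse_perturb[OF u _ Md] by (auto simp: M_def)
      have eq: "1 - l *\<^sub>C a + d = 1 - k *\<^sub>C a"
        by (simp add: d_def cvs.scale_left_diff_distrib)
      have "2 * M\<^sup>2 * norm d = 2 * M * (M * norm d)" by (simp add: power2_eq_square)
      also have "\<dots> \<le> 2 * M * (1/2)" using Md M by (intro mult_left_mono) simp_all
      finally have "norm (w - u) \<le> M" using w by simp
      then have "norm w \<le> norm u + M" using norm_triangle_sub[of w u] by linarith
      with w show ?thesis unfolding eq by blast
    qed
    with r show ?thesis by blast
  qed
  then obtain r N where rN: "\<And>l. cmod l = 1 \<Longrightarrow> 0 < r l \<and> (\<forall>k\<in>ball l (r l). ?P k (N l))"
    by metis
  have "compact (sphere (0::complex) 1)" by simp
  moreover have "sphere 0 1 \<subseteq> (\<Union>l\<in>sphere 0 1. ball l (r l))"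
    using rN by force
  ultimately obtain T where T: "T \<subseteq> sphere 0 1" "finite T" "sphere 0 1 \<subseteq> (\<Union>l\<in>T. ball l (r l))"
    using compactE_image[of "sphere 0 1" "sphere 0 1" "\<lambda>l. ball l (r l)"] by auto
  define M where "M = 1 + (\<Sum>l\<in>T. \<bar>N l\<bar>)"
  have "M > 0" by (simp add: M_def add_pos_nonneg sum_nonneg)
  moreover have "?P k M" if k: "cmod k = 1" for k
  proof -
    obtain l where l: "l \<in> T" "k \<in> ball l (r l)" using k T(3) by force
    then have "?P k (N l)" using rN T by force
    moreover have "N l \<le> M"
      using member_le_sum[of l T "\<lambda>l. \<bar>N l\<bar>"] l T unfolding M_def by fastforce
    ultimately show ?thesis using order_trans by blast
  qed
  ultimately show ?thesis by (rule that)
qed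

lemma norm_power_self_adjoint:
  assumes "star a = (a::'a::unital_cstar_algebra)"
  shows "star (a ^ 2 ^ m) = a ^ 2 ^ m \<and> norm (a ^ 2 ^ m) = norm a ^ 2 ^ m"
proof (induction m)
  case (Suc m)
  let ?x = "a ^ 2 ^ m"
  have eq: "a ^ 2 ^ Suc m = ?x * ?x" by (simp add: power_add mult_2)
  have "norm (star ?x * ?x) = (norm ?x)\<^sup>2" by (rule norm_star_mult_self)
  with Suc show ?case unfolding eq
    by (simp add: star_mult power2_eq_square power_add mult_2)
qed (simp add: assms)

text \<open>A substitute for the spectral radius formula. For \<open>t < 1\<close> close to \<open>1\<close>, the resolvents of \<open>a\<close> and \<open>t a\<close> on
the unit circle are uniformly close. By repeated doubling the same holds for \<open>a ^ 2 ^ m\<close> and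
\<open>(t a) ^ 2 ^ m\<close>. The latter tends to \<open>0\<close>, so that the inverse of \<open>1 - a ^ 2 ^ m\<close> comes close to \<open>1\<close>.\<close>

lemma has_inverse_circle_imp_power_small:
  fixes a :: "'a::unital_cstar_algebra"
  assumes inv: "\<And>l. cmod l = 1 \<Longrightarrow> has_inverse (1 - l *\<^sub>C a)" and a: "norm a \<le> 1"
  shows "\<exists>m. norm (a ^ 2 ^ m) < 1"
proof -
  obtain M where M: "0 < M" "\<And>l. cmod l = 1 \<Longrightarrow>
    \<exists>u. u * (1 - l *\<^sub>C a) = 1 \<and> (1 - l *\<^sub>C a) * u = 1 \<and> norm u \<le> M"
    using has_inverse_bound_on_circle[OF inv] by metis
  \<comment> \<open>small enough for the perturbation lemma, which then changes inverses by at most \<open>1/8\<close>\<close>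
  define s where "s = min (1/2) (min (1 / (2 * M)) (1 / (16 * M\<^sup>2)))"
  define t where "t = 1 - s"
  have s: "0 < s" "s \<le> 1/2" "s \<le> 1 / (2 * M)" "s \<le> 1 / (16 * M\<^sup>2)"
    using M(1) by (simp_all add: s_def)
  have t: "0 < t" "t < 1" using s by (simp_all add: t_def)
  let ?Q = "\<lambda>x y. \<forall>l. cmod l = 1 \<longrightarrow> (\<exists>u v. u * (1 - l *\<^sub>C x) = 1 \<and> (1 - l *\<^sub>C x) * u = 1 \<and>
      v * (1 - l *\<^sub>C y) = 1 \<and> (1 - l *\<^sub>C y) * v = 1 \<and> norm (u - v) \<le> 1/8)"
  have base: "?Q a (t *\<^sub>R a)"
  proof (intro allI impI)
    fix l :: complex assume l: "cmod l = 1"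
    obtain u where u: "u * (1 - l *\<^sub>C a) = 1" "(1 - l *\<^sub>C a) * u = 1" "norm u \<le> M"
      using M(2)[OF l] by blast
    define d where "d = (l * s) *\<^sub>C a"
    have nd: "norm d \<le> s" using a l s by (simp add: d_def norm_scaleC norm_mult mult_left_le)
    have "M * norm d \<le> M * s" using nd M by simp
    also have "\<dots> \<le> 1/2" using s M by (simp add: field_simps)
    finally have Md: "M * norm d \<le> 1/2" .
    obtain w where w: "w * (1 - l *\<^sub>C a + d) = 1" "(1 - l *\<^sub>C a + d) * w = 1" "norm (w - u) \<le> 2 * M\<^sup>2 * norm d"
      using inverse_perturb[OF u Md] by blast
    have eq: "1 - l *\<^sub>C a + d = 1 - l *\<^sub>C (t *\<^sub>R a)"
      by (simp add: d_def t_def scaleR_scaleC scaleC_scaleC cvs.scale_left_diff_distrib algebra_simps)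
    have "2 * M\<^sup>2 * norm d \<le> 2 * M\<^sup>2 * s" using nd by (simp add: mult_left_mono)
    also have "\<dots> \<le> 1/8" using s M by (simp add: field_simps)
    finally have "norm (u - w) \<le> 1/8" using w by (simp add: norm_minus_commute)
    with u w show "\<exists>u v. u * (1 - l *\<^sub>C a) = 1 \<and> (1 - l *\<^sub>C a) * u = 1 \<and>
      v * (1 - l *\<^sub>C t *\<^sub>R a) = 1 \<and> (1 - l *\<^sub>C t *\<^sub>R a) * v = 1 \<and> norm (u - v) \<le> 1/8"
      unfolding eq by blast
  qed
  have all: "?Q (a ^ 2 ^ m) ((t *\<^sub>R a) ^ 2 ^ m)" for m
  proof (induction m)
    case 0
    show ?case using base by simp
  next
    case (Suc m)
    have "z ^ 2 ^ Suc m = (z ^ 2 ^ m)\<^sup>2" for z :: 'a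
      by (simp add: power_mult[symmetric] mult.commute)
    then show ?case
      using Suc doubling_step[of "a ^ 2 ^ m" "(t *\<^sub>R a) ^ 2 ^ m" "1/8"] by auto
  qed
  have "(\<lambda>n. t ^ n) \<longlonglongrightarrow> 0" using t by (intro LIMSEQ_power_zero) simp
  then obtain n0 where n0: "\<And>n. n \<ge> n0 \<Longrightarrow> t ^ n < 1/16"
    using order_tendstoD(2)[of "\<lambda>n. t ^ n" 0 sequentially "1/16"] by (auto simp: eventually_sequentially)
  define y where "y = (t *\<^sub>R a) ^ 2 ^ n0"
  have "n0 \<le> 2 ^ n0" using less_exp[of n0] by simp
  have "norm y \<le> norm (t *\<^sub>R a) ^ 2 ^ n0" unfolding y_def by (rule norm_power_ineq)
  also have "\<dots> \<le> t ^ 2 ^ n0" using a t by (intro power_mono) (simp_all add: mult_left_le)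
  also have "\<dots> < 1/16" by (rule n0) fact
  finally have ny: "norm y < 1/16" .
  obtain u v where uv: "u * (1 - 1 *\<^sub>C a ^ 2 ^ n0) = 1" "(1 - 1 *\<^sub>C a ^ 2 ^ n0) * u = 1"
      "v * (1 - 1 *\<^sub>C y) = 1" "(1 - 1 *\<^sub>C y) * v = 1" "norm (u - v) \<le> 1/8"
    using all[of n0] unfolding y_def by (metis norm_one)
  define x where "x = a ^ 2 ^ n0"
  have "v - 1 = v * y" using uv(3) by (simp add: scaleC_one algebra_simps)
  then have "norm (v - 1) \<le> norm v * norm y" by (simp add: norm_mult_ineq)
  also have "\<dots> \<le> (norm (v - 1) + 1) * (1/16)"
    using norm_triangle_sub[of v 1] ny by (intro mult_mono) auto
  finally have "norm (v - 1) \<le> 1/8" by simp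
  then have u1: "norm (1 - u) \<le> 1/4"
    using uv(5) norm_triangle_ineq[of "u - v" "v - 1"] by (simp add: norm_minus_commute)
  have "x = (u - 1) + (1 - u) * x" using uv(1) by (simp add: scaleC_one x_def algebra_simps)
  then have "norm x \<le> norm (u - 1) + norm ((1 - u) * x)" by (metis norm_triangle_ineq)
  also have "\<dots> \<le> 1/4 + 1/4 * norm x"
    using u1 order_trans[OF norm_mult_ineq mult_right_mono[OF u1, of "norm x"]]
    by (simp add: norm_minus_commute)
  finally have "norm x < 1" by simp
  then show ?thesis unfolding x_def by blast
qed

lemma norm_attained_in_spectrum:
  fixes a :: "'a::unital_cstar_algebra"
  assumes a: "self_adjoint a"
  shows "\<exists>l\<in>spectrum a. cmod l = norm a"
proof (cases "a = 0")
  case True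
  then have "0 \<in> spectrum a"
    by (simp add: spectrum_iff has_inverse_def)
  with True show ?thesis by force
next
  case False
  define b where "b = (1 / norm a) *\<^sub>R a"
  have b: "norm b = 1" using False by (simp add: b_def)
  have "star b = b"
    using a by (simp add: b_def self_adjoint_def scaleR_scaleC star_scaleC)
  then have pow: "norm (b ^ 2 ^ m) = 1" for m
    using norm_power_self_adjoint[of b m] b by simp
  show ?thesis
  proof (rule ccontr)
    assume no: "\<not> ?thesis"
    have "has_inverse (1 - l *\<^sub>C b)" if l: "cmod l = 1" for l
    proof -
      define k where "k = norm a / l"
      have "l \<noteq> 0" using l by auto
      then have k: "k \<noteq> 0" "cmod k = norm a" using False l by (simp_all add: k_def norm_divide)
      then have "has_inverse (k *\<^sub>C 1 - a)" using no by (auto simp: spectrum_iff)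
      then have "has_inverse ((1/k) *\<^sub>C (k *\<^sub>C 1 - a))" using k by (intro has_inverse_scaleC) simp_all
      moreover have "(1/k) *\<^sub>C (k *\<^sub>C 1 - a) = 1 - l *\<^sub>C b"
        using k by (simp add: b_def k_def cvs.scale_right_diff_distrib scaleC_scaleC scaleC_one scaleR_scaleC)
      ultimately show ?thesis by simp
    qed
    then obtain m where "norm (b ^ 2 ^ m) < 1"
      using has_inverse_circle_imp_power_small[of b] b by auto
    with pow show False by simp
  qed
qed

lemma spectrum_norm_le:
  assumes "l \<in> spectrum (a::'a::unital_cstar_algebra)"
  shows "cmod l \<le> norm a"
proof (rule ccontr)
  assume "\<not> ?thesis"
  then have l: "norm a < cmod l" by simp
  then have l0: "l \<noteq> 0" by auto
  have "has_inverse (1 - (1/l) *\<^sub>C a)"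
    by (rule has_inverse_one_minus) (use l l0 in \<open>simp add: norm_scaleC norm_divide\<close>)
  then have "has_inverse (l *\<^sub>C (1 - (1/l) *\<^sub>C a))" using l0 by (rule has_inverse_scaleC)
  moreover have "l *\<^sub>C (1 - (1/l) *\<^sub>C a) = l *\<^sub>C 1 - a"
    using l0 by (simp add: cvs.scale_right_diff_distrib scaleC_scaleC scaleC_one)
  ultimately show False using assms by (simp add: spectrum_iff)
qed

section \<open>The involution and real spectra\<close>

lemma star_zero [simp]: "star (0::'a::unital_cstar_algebra) = 0"
  using star_add[of 0 "0::'a"] by simp

lemma star_minus: "star (- x) = - star (x::'a::unital_cstar_algebra)"
  using star_add[of x "- x"] by (simp add: eq_neg_iff_add_eq_0 add.commute)

lemma star_diff: "star (x - y) = star x - star (y::'a::unital_cstar_algebra)"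
  using star_add[of x "- y"] by (simp add: star_minus)

lemma star_one [simp]: "star (1::'a::unital_cstar_algebra) = 1"
  using star_mult[of "star 1" "1::'a"] by (simp add: star_star)

lemma norm_star: "norm (star x) = norm (x::'a::unital_cstar_algebra)"
proof -
  have le: "norm y \<le> norm (star y)" for y :: 'a
  proof (cases "y = 0")
    case False
    have "(norm y)\<^sup>2 \<le> norm (star y) * norm y"
      using norm_mult_ineq[of "star y" y] by (simp add: norm_star_mult_self)
    with False show ?thesis by (simp add: power2_eq_square)
  qed simp
  from le[of x] le[of "star x"] show ?thesis by (simp add: star_star)
qed

lemma tendsto_star:
  assumes "(f \<longlongrightarrow> (l::'a::unital_cstar_algebra)) F"
  shows "((\<lambda>x. star (f x)) \<longlongrightarrow> star l) F"
proof -
  have "((\<lambda>x. norm (star (f x) - star l)) \<longlongrightarrow> 0) F"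
    using assms unfolding star_diff[symmetric] norm_star
    by (simp add: LIM_zero_iff tendsto_norm_zero_iff)
  then show ?thesis by (simp add: LIM_zero_iff tendsto_norm_zero_iff)
qed

text \<open>Arens' trick: adding \<open>\<i> s\<close> to \<open>a\<close>, for real \<open>s\<close>, gives an element of squared norm at most
\<open>(norm a)\<^sup>2 + s\<^sup>2\<close>, whereas the squared modulus of a spectral value \<open>l\<close> grows by \<open>s\<^sup>2 + 2 s Im l\<close>.\<close>

lemma spectrum_self_adjoint_real:
  fixes a :: "'a::unital_cstar_algebra"
  assumes a: "self_adjoint a" and l: "l \<in> spectrum a"
  shows "Im l = 0"
proof (rule ccontr)
  assume im: "Im l \<noteq> 0"
  have key: "(cmod (l + \<i> * of_real s))\<^sup>2 \<le> (norm a)\<^sup>2 + s\<^sup>2" for s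
  proof -
    define c where "c = (\<i> * of_real s :: complex)"
    define x where "x = a + c *\<^sub>C 1"
    have "l + c \<in> spectrum x"
      using l by (simp add: spectrum_iff x_def scaleC_add_left)
    then have "(cmod (l + c))\<^sup>2 \<le> (norm x)\<^sup>2" by (intro power_mono spectrum_norm_le) simp_all
    also have "\<dots> = norm (star x * x)" by (simp add: norm_star_mult_self)
    also have "star x * x = star a * a + (of_real (s\<^sup>2)) *\<^sub>C 1"
    proof -
      have "star x = a + (- c) *\<^sub>C 1"
        using a by (simp add: x_def star_add star_scaleC self_adjoint_def c_def)
      moreover have "c * c = - of_real (s\<^sup>2)" by (simp add: c_def complex_eq_iff power2_eq_square)
      then have "c *\<^sub>C c *\<^sub>C (1::'a) = - (of_real (s\<^sup>2) *\<^sub>C 1)"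
        by (simp only: scaleC_scaleC cvs.scale_minus_left)
      ultimately show ?thesis
        using a by (simp add: x_def distrib_left distrib_right left_diff_distrib mult_scaleC_left mult_scaleC_right cvs.scale_right_diff_distrib self_adjoint_def)
    qed
    also have "norm \<dots> \<le> (norm a)\<^sup>2 + s\<^sup>2"
      by (rule norm_triangle_le) (simp add: norm_star_mult_self norm_scaleC norm_power)
    finally show ?thesis by (simp add: c_def)
  qed
  \<comment> \<open>makes the term linear in \<open>s\<close> equal to \<open>(norm a)\<^sup>2 + 1\<close>\<close>
  define s where "s = ((norm a)\<^sup>2 + 1) / (2 * Im l)"
  have "(Re l)\<^sup>2 + (Im l + s)\<^sup>2 \<le> (norm a)\<^sup>2 + s\<^sup>2"
    using key[of s] by (simp add: cmod_power2)
  then have "(Re l)\<^sup>2 + (Im l)\<^sup>2 + 2 * Im l * s \<le> (norm a)\<^sup>2" by (simp add: power2_eq_square algebra_simps)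
  moreover have "2 * Im l * s = (norm a)\<^sup>2 + 1" using im by (simp add: s_def)
  ultimately show False by (smt (verit) zero_le_power2)
qed

lemma spectrum_self_adjoint_eq:
  assumes "self_adjoint a" "l \<in> spectrum a"
  shows "l = complex_of_real (Re l)" "cnj l = l"
  using spectrum_self_adjoint_real[OF assms] by (simp_all add: complex_eq_iff)

lemma closed_spectrum: "closed (spectrum (a::'a::unital_cstar_algebra))"
proof -
  have "open (- spectrum a)"
  proof (subst open_contains_ball, intro ballI)
    fix l assume "l \<in> - spectrum a"
    then obtain u where u: "u * (l *\<^sub>C 1 - a) = 1" "(l *\<^sub>C 1 - a) * u = 1"
      by (auto simp: spectrum_iff has_inverse_def)
    define r where "r = 1 / (2 * (norm u + 1))"
    have np: "norm u + 1 > 0" by (simp add: add_nonneg_pos)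
    have "k \<notin> spectrum a" if "k \<in> ball l r" for k
    proof -
      define d where "d = (k - l) *\<^sub>C (1::'a)"
      have "(norm u + 1) * norm d \<le> (norm u + 1) * r"
        using that np by (intro mult_left_mono) (simp_all add: d_def norm_scaleC dist_norm norm_minus_commute)
      also have "\<dots> \<le> 1/2" using np by (simp add: r_def field_simps)
      finally obtain w where w: "w * (l *\<^sub>C 1 - a + d) = 1" "(l *\<^sub>C 1 - a + d) * w = 1"
        using inverse_perturb[OF u, of "norm u + 1" d] by auto
      moreover have "l *\<^sub>C 1 - a + d = k *\<^sub>C 1 - a" by (simp add: d_def cvs.scale_left_diff_distrib)
      ultimately show ?thesis by (auto simp: spectrum_iff has_inverse_def)
    qed
    moreover have "r > 0" using np by (simp add: r_def)
    ultimately show "\<exists>e>0. ball l e \<subseteq> - spectrum a" by blast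
  qed
  then show ?thesis by (simp add: closed_def)
qed

lemma compact_spectrum: "compact (spectrum (a::'a::unital_cstar_algebra))"
  unfolding compact_eq_bounded_closed
  using closed_spectrum spectrum_norm_le by (auto simp: bounded_iff)

section \<open>Polynomial functional calculus\<close>

text \<open>Evaluation of a complex polynomial at an element of the algebra, by Horner's rule.\<close>

definition poly_calc :: "'a::unital_cstar_algebra \<Rightarrow> complex poly \<Rightarrow> 'a"
  where "poly_calc a p = fold_coeffs (\<lambda>c y. c *\<^sub>C 1 + a * y) p 0"

lemma poly_calc_0 [simp]: "poly_calc a 0 = 0"
  by (simp add: poly_calc_def)

lemma poly_calc_pCons [simp]: "poly_calc a (pCons c p) = c *\<^sub>C 1 + a * poly_calc a p"
  by (cases "p = 0 \<and> c = 0") (auto simp: poly_calc_def)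

lemma poly_calc_add: "poly_calc a (p + q) = poly_calc a p + poly_calc a q"
  by (induction p q rule: poly_induct2) (simp_all add: scaleC_add_left distrib_left)

lemma poly_calc_smult: "poly_calc a (smult c p) = c *\<^sub>C poly_calc a p"
  by (induction p) (simp_all add: scaleC_add_right scaleC_scaleC mult_scaleC_right)

lemma poly_calc_diff: "poly_calc a (p - q) = poly_calc a p - poly_calc a q"
  using poly_calc_add[of a "p - q" q] by simp

lemma poly_calc_mult: "poly_calc a (p * q) = poly_calc a p * poly_calc a q"
  by (induction p)
    (simp_all add: poly_calc_add poly_calc_smult distrib_right mult_scaleC_left mult.assoc)

lemma poly_calc_star:
  assumes "self_adjoint a"
  shows "star (poly_calc a p) = poly_calc a (map_poly cnj p)"
proof -
  have "poly_calc a p * a = a * poly_calc a p" for p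
    using poly_calc_mult[of a p "[:0, 1:]"] poly_calc_mult[of a "[:0, 1:]" p]
    by (simp add: scaleC_one mult.commute)
  then show ?thesis
    using assms
    by (induction p) (simp_all add: map_poly_pCons star_add star_mult star_scaleC self_adjoint_def)
qed

lemma poly_map_poly_cnj: "poly (map_poly cnj p) z = cnj (poly p (cnj z))"
  by (induction p) (simp_all add: map_poly_pCons)

lemma has_inverse_poly_calc:
  assumes "p \<noteq> 0" "\<And>z. z \<in> spectrum a \<Longrightarrow> poly p z \<noteq> 0"
  shows "has_inverse (poly_calc a p)"
  using assms
proof (induction "degree p" arbitrary: p)
  case 0
  then obtain c where "p = [:c:]" using degree_eq_zeroE by metis
  with 0 show ?case
    using has_inverse_scaleC[of 1 c] by (auto simp: has_inverse_def)
next
  case (Suc n)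
  then have "\<not> constant (poly p)" by (simp add: constant_degree)
  then obtain r where "poly p r = 0" using fundamental_theorem_of_algebra by blast
  then obtain q where q: "p = [:- r, 1:] * q" by (metis dvdE poly_eq_0_iff_dvd)
  with Suc.prems have "q \<noteq> 0" by auto
  then have "degree p = Suc (degree q)" unfolding q by (subst degree_mult_eq) simp_all
  then have "has_inverse (poly_calc a q)"
    using Suc q \<open>q \<noteq> 0\<close> by (intro Suc.hyps) auto
  moreover have "has_inverse (poly_calc a [:- r, 1:])"
  proof -
    have "r \<notin> spectrum a" using Suc.prems \<open>poly p r = 0\<close> by blast
    then have "has_inverse (- (r *\<^sub>C 1 - a))"
      by (intro has_inverse_uminus) (simp add: spectrum_iff)
    then show ?thesis by (simp add: scaleC_one)
  qed
  ultimately show ?case unfolding q poly_calc_mult by (intro has_inverse_mult)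
qed

lemma spectrum_nonempty_self_adjoint: "self_adjoint a \<Longrightarrow> spectrum a \<noteq> {}"
  using norm_attained_in_spectrum by blast

lemma self_adjoint_star_mult: "self_adjoint (star x * x)"
  by (simp add: self_adjoint_def star_mult star_star)

text \<open>By the C*-identity, \<open>(norm p(a))\<^sup>2\<close> is the norm of \<open>q(a)\<close> for \<open>q = cnj p * p\<close>, hence the modulus of a
spectral value of \<open>q(a)\<close>, and every such value is \<open>q z = \<bar>p z\<bar>\<^sup>2\<close> for some \<open>z\<close> in the spectrum of \<open>a\<close>.\<close>

lemma norm_poly_calc_le:
  assumes a: "self_adjoint a" and B: "\<And>z. z \<in> spectrum a \<Longrightarrow> cmod (poly p z) \<le> B"
  shows "norm (poly_calc a p) \<le> B"
proof -
  define q where "q = map_poly cnj p * p"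
  have q: "star (poly_calc a p) * poly_calc a p = poly_calc a q"
    by (simp add: q_def poly_calc_mult poly_calc_star[OF a])
  then have "self_adjoint (poly_calc a q)"
    using self_adjoint_star_mult[of "poly_calc a p"] by simp
  then obtain l where l: "l \<in> spectrum (poly_calc a q)" "cmod l = norm (poly_calc a q)"
    using norm_attained_in_spectrum by blast
  obtain z where z: "z \<in> spectrum a" "poly q z = l"
  proof -
    have "\<not> has_inverse (poly_calc a ([:l:] - q))"
      using l by (simp add: poly_calc_diff spectrum_iff)
    then have "[:l:] - q = 0 \<or> (\<exists>z\<in>spectrum a. poly ([:l:] - q) z = 0)"
      using has_inverse_poly_calc by blast
    then have "\<exists>z\<in>spectrum a. poly ([:l:] - q) z = 0"
      using spectrum_nonempty_self_adjoint[OF a] by auto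
    with that show ?thesis by auto
  qed
  have "(norm (poly_calc a p))\<^sup>2 = cmod l"
    using l(2) q norm_star_mult_self[of "poly_calc a p"] by simp
  also have "\<dots> = (cmod (poly p z))\<^sup>2"
    using z(2) spectrum_self_adjoint_eq(2)[OF a z(1)]
    by (auto simp: q_def poly_map_poly_cnj norm_mult power2_eq_square)
  also have "\<dots> \<le> B\<^sup>2" using B[OF z(1)] by (simp add: power_mono)
  finally show ?thesis
    using B[OF z(1)] norm_ge_zero order_trans power2_le_imp_le by blast
qed

lemma Stone_Weierstrass_complex_poly:
  fixes h :: "complex \<Rightarrow> complex"
  assumes S: "compact S" "S \<subseteq> \<real>" and h: "continuous_on S h" and e: "0 < e"
  obtains p where "\<And>z. z \<in> S \<Longrightarrow> cmod (h z - poly p z) < e"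
proof -
  have real: "\<exists>p. \<forall>z\<in>S. cmod (complex_of_real (k z) - poly p z) < e / 2"
    if k: "continuous_on S k" for k
  proof -
    have "continuous_on (Re ` S) (\<lambda>x. k (of_real x))"
    proof (rule continuous_on_compose2[OF k])
      show "of_real ` Re ` S \<subseteq> S" using S(2) by (auto simp: of_real_Re)
    qed (intro continuous_intros)
    moreover have "compact (Re ` S)"
      by (intro compact_continuous_image S continuous_intros)
    ultimately obtain g where g: "real_polynomial_function g"
        "\<And>x. x \<in> Re ` S \<Longrightarrow> \<bar>k (of_real x) - g x\<bar> < e / 2"
      using Stone_Weierstrass_real_polynomial_function[of "Re ` S" "\<lambda>x. k (of_real x)" "e/2"] e by auto
    obtain c n where c: "g = (\<lambda>x. \<Sum>i\<le>n. c i * x ^ i)"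
      using g(1) real_polynomial_function_iff_sum by blast
    define p where "p = (\<Sum>i\<le>n. monom (complex_of_real (c i)) i)"
    have "cmod (complex_of_real (k z) - poly p z) < e / 2" if "z \<in> S" for z
    proof -
      have z: "complex_of_real (Re z) = z" using that S(2) by (auto simp: of_real_Re)
      have "poly p (complex_of_real (Re z)) = complex_of_real (g (Re z))"
        by (simp add: p_def poly_sum poly_monom c)
      then have "complex_of_real (k z) - poly p z = complex_of_real (k (of_real (Re z)) - g (Re z))"
        by (simp add: z)
      then show ?thesis using g(2)[of "Re z"] that by (simp only: norm_of_real) simp
    qed
    then show ?thesis by blast
  qed
  have "continuous_on S (\<lambda>z. Re (h z))" "continuous_on S (\<lambda>z. Im (h z))"
    using h by (auto intro: continuous_intros)
  from this[THEN real] obtain p q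
    where p: "\<forall>z\<in>S. cmod (complex_of_real (Re (h z)) - poly p z) < e / 2"
      and q: "\<forall>z\<in>S. cmod (complex_of_real (Im (h z)) - poly q z) < e / 2" by blast
  have "cmod (h z - poly (p + smult \<i> q) z) < e" if "z \<in> S" for z
  proof -
    have "h z - poly (p + smult \<i> q) z =
      (complex_of_real (Re (h z)) - poly p z) + \<i> * (complex_of_real (Im (h z)) - poly q z)"
      by (subst (1) complex_eq[of "h z"]) (simp add: algebra_simps)
    also have "cmod \<dots> \<le> cmod (complex_of_real (Re (h z)) - poly p z) + cmod (complex_of_real (Im (h z)) - poly q z)"
      by (rule norm_triangle_le) (simp add: norm_mult)
    also have "\<dots> < e" using p q that by (smt (verit) field_sum_of_halves)
    finally show ?thesis .
  qed
  then show ?thesis by (rule that)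
qed

lemma spectrum_self_adjoint_subset_Reals: "self_adjoint a \<Longrightarrow> spectrum a \<subseteq> \<real>"
  using spectrum_self_adjoint_eq(1) by (metis Reals_of_real subsetI)

section \<open>Existence of the continuous functional calculus\<close>

text \<open>\<open>poly_limit a h x\<close> says that \<open>x\<close> is the limit of \<open>p\<^sub>n(a)\<close> for some polynomials \<open>p\<^sub>n\<close> that converge to \<open>h\<close>
uniformly on the spectrum of \<open>a\<close>. For self-adjoint \<open>a\<close> and continuous \<open>h\<close> there is exactly one such \<open>x\<close>,
and it is \<open>h(a)\<close>.\<close>

definition poly_limit :: "'a::unital_cstar_algebra \<Rightarrow> (complex \<Rightarrow> complex) \<Rightarrow> 'a \<Rightarrow> bool"
  where "poly_limit a h x \<longleftrightarrow>
    (\<exists>p. uniform_limit (spectrum a) (\<lambda>n z. poly (p n) z) h sequentially \<and>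
         (\<lambda>n. poly_calc a (p n)) \<longlonglongrightarrow> x)"

lemma poly_limitI:
  assumes "\<And>n z. z \<in> spectrum a \<Longrightarrow> poly (p n) z = f n z"
    and "uniform_limit (spectrum a) f h sequentially"
    and "(\<lambda>n. poly_calc a (p n)) \<longlonglongrightarrow> x"
  shows "poly_limit a h x"
proof -
  have "uniform_limit (spectrum a) (\<lambda>n z. poly (p n) z) h sequentially"
    using assms(2) by (rule uniform_limit_cong'[THEN iffD1, rotated -1]) (simp_all add: assms(1))
  with assms(3) show ?thesis unfolding poly_limit_def by blast
qed

lemma poly_limit_poly: "poly_limit a (poly p) (poly_calc a p)"
  unfolding poly_limit_def
  by (rule exI[of _ "\<lambda>n. p"]) (auto intro: uniform_limit_const)

lemma poly_limit_cong: "(\<And>z. z \<in> spectrum a \<Longrightarrow> h z = k z) \<Longrightarrow> poly_limit a h x = poly_limit a k x"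
  unfolding poly_limit_def by (metis (no_types, lifting) uniform_limit_cong')

lemma poly_limit_norm_le:
  assumes a: "self_adjoint a" and x: "poly_limit a h x" and B: "\<And>z. z \<in> spectrum a \<Longrightarrow> cmod (h z) \<le> B"
  shows "norm x \<le> B"
proof -
  obtain p where p: "uniform_limit (spectrum a) (\<lambda>n z. poly (p n) z) h sequentially"
    "(\<lambda>n. poly_calc a (p n)) \<longlonglongrightarrow> x" using x by (auto simp: poly_limit_def)
  show ?thesis
  proof (rule field_le_epsilon)
    fix e :: real assume "0 < e"
    with p(1) have "\<forall>\<^sub>F n in sequentially. \<forall>z\<in>spectrum a. dist (poly (p n) z) (h z) < e"
      by (auto dest: uniform_limitD)
    then have "\<forall>\<^sub>F n in sequentially. norm (poly_calc a (p n)) \<le> B + e"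
    proof eventually_elim
      case (elim n)
      have "cmod (poly (p n) z) \<le> B + e" if "z \<in> spectrum a" for z
      proof -
        have "cmod (poly (p n) z) \<le> cmod (h z) + dist (poly (p n) z) (h z)"
          unfolding dist_norm by (rule norm_triangle_sub)
        also have "\<dots> \<le> B + e" using elim that B[OF that] by (intro add_mono) (auto simp: less_imp_le)
        finally show ?thesis .
      qed
      then show ?case by (rule norm_poly_calc_le[OF a])
    qed
    then show "norm x \<le> B + e"
      using tendsto_upperbound[OF tendsto_norm[OF p(2)]] by simp
  qed
qed

lemma poly_limit_scaleC:
  assumes "poly_limit a h x"
  shows "poly_limit a (\<lambda>z. c * h z) (c *\<^sub>C x)"
proof -
  obtain p where p: "uniform_limit (spectrum a) (\<lambda>n z. poly (p n) z) h sequentially"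
    "(\<lambda>n. poly_calc a (p n)) \<longlonglongrightarrow> x" using assms by (auto simp: poly_limit_def)
  have "(\<lambda>n. (c *\<^sub>C 1) * poly_calc a (p n)) \<longlonglongrightarrow> (c *\<^sub>C 1) * x"
    by (intro tendsto_intros p)
  then show ?thesis
    by (intro poly_limitI[OF _ bounded_linear.uniform_limit[OF bounded_linear_mult_right p(1)], of "\<lambda>n. smult c (p n)"])
       (simp_all add: poly_calc_smult mult_scaleC_left)
qed

lemma poly_limit_add:
  assumes "poly_limit a h x" "poly_limit a k y"
  shows "poly_limit a (\<lambda>z. h z + k z) (x + y)"
proof -
  obtain p q where p: "uniform_limit (spectrum a) (\<lambda>n z. poly (p n) z) h sequentially"
    "(\<lambda>n. poly_calc a (p n)) \<longlonglongrightarrow> x" and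
    q: "uniform_limit (spectrum a) (\<lambda>n z. poly (q n) z) k sequentially"
    "(\<lambda>n. poly_calc a (q n)) \<longlonglongrightarrow> y" using assms by (auto simp: poly_limit_def)
  show ?thesis
    by (rule poly_limitI[OF _ uniform_limit_add[OF p(1) q(1)], of "\<lambda>n. p n + q n"])
       (use tendsto_add[OF p(2) q(2)] in \<open>simp_all add: poly_calc_add\<close>)
qed

lemma bounded_continuous_image_spectrum:
  "continuous_on (spectrum a) h \<Longrightarrow> bounded ((h :: _ \<Rightarrow> 'b::metric_space) ` spectrum a)"
  by (intro compact_imp_bounded compact_continuous_image compact_spectrum)

lemma poly_limit_mult:
  assumes "poly_limit a h x" "poly_limit a k y"
    and "continuous_on (spectrum a) h" "continuous_on (spectrum a) k"
  shows "poly_limit a (\<lambda>z. h z * k z) (x * y)"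
proof -
  obtain p q where p: "uniform_limit (spectrum a) (\<lambda>n z. poly (p n) z) h sequentially"
    "(\<lambda>n. poly_calc a (p n)) \<longlonglongrightarrow> x" and
    q: "uniform_limit (spectrum a) (\<lambda>n z. poly (q n) z) k sequentially"
    "(\<lambda>n. poly_calc a (q n)) \<longlonglongrightarrow> y" using assms by (auto simp: poly_limit_def)
  show ?thesis
    by (rule poly_limitI[OF _ uniform_lim_mult[OF p(1) q(1)], of "\<lambda>n. p n * q n"])
       (use tendsto_mult[OF p(2) q(2)] assms(3,4) in
         \<open>simp_all add: poly_calc_mult bounded_continuous_image_spectrum\<close>)
qed

lemma poly_limit_cnj:
  assumes a: "self_adjoint a" and "poly_limit a h x"
  shows "poly_limit a (\<lambda>z. cnj (h z)) (star x)"
proof -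
  obtain p where p: "uniform_limit (spectrum a) (\<lambda>n z. poly (p n) z) h sequentially"
    "(\<lambda>n. poly_calc a (p n)) \<longlonglongrightarrow> x" using assms by (auto simp: poly_limit_def)
  show ?thesis
    by (rule poly_limitI[OF _ bounded_linear.uniform_limit[OF bounded_linear_cnj p(1)], of "\<lambda>n. map_poly cnj (p n)"])
       (use tendsto_star[OF p(2)] in
         \<open>simp_all add: poly_calc_star[OF a] poly_map_poly_cnj spectrum_self_adjoint_eq(2)[OF a]\<close>)
qed

lemma poly_limit_unique:
  assumes "self_adjoint a" "poly_limit a h x" "poly_limit a h y"
  shows "x = y"
proof -
  have "poly_limit a (\<lambda>z. h z + (-1) * h z) (x + (-1) *\<^sub>C y)"
    using assms by (intro poly_limit_add poly_limit_scaleC)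
  then have "norm (x + (-1) *\<^sub>C y) \<le> 0"
    by (rule poly_limit_norm_le[OF assms(1)]) simp
  then show ?thesis by (simp add: scaleC_one)
qed

lemma poly_limit_exists:
  assumes a: "self_adjoint a" and h: "continuous_on (spectrum a) h"
  shows "\<exists>x. poly_limit a h x"
proof -
  have "\<exists>p. \<forall>z\<in>spectrum a. cmod (h z - poly p z) < inverse (real (Suc n))" for n
    using Stone_Weierstrass_complex_poly[OF compact_spectrum spectrum_self_adjoint_subset_Reals[OF a] h, of "inverse (real (Suc n))"]
    by (metis inverse_positive_iff_positive of_nat_0_less_iff zero_less_Suc)
  then obtain p where p: "\<And>n z. z \<in> spectrum a \<Longrightarrow> cmod (h z - poly (p n) z) < inverse (real (Suc n))"
    by metis
  have small: "\<exists>N. \<forall>n\<ge>N. inverse (real (Suc n)) < e" if "0 < e" for e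
    using order_tendstoD(2)[OF LIMSEQ_inverse_real_of_nat that] by (simp add: eventually_sequentially)
  have "uniform_limit (spectrum a) (\<lambda>n z. poly (p n) z) h sequentially"
  proof (rule uniform_limitI)
    fix e :: real assume "0 < e"
    then obtain N where "\<forall>n\<ge>N. inverse (real (Suc n)) < e" using small by blast
    then show "\<forall>\<^sub>F n in sequentially. \<forall>z\<in>spectrum a. dist (poly (p n) z) (h z) < e"
      unfolding eventually_sequentially dist_norm norm_minus_commute[of "poly _ _"]
      using p less_trans by blast
  qed
  moreover have "Cauchy (\<lambda>n. poly_calc a (p n))"
  proof (rule metric_CauchyI)
    fix e :: real assume "0 < e"
    then obtain N where N: "\<And>n. n \<ge> N \<Longrightarrow> inverse (real (Suc n)) < e / 3" using small[of "e/3"] by auto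
    have "dist (poly_calc a (p m)) (poly_calc a (p n)) < e" if mn: "m \<ge> N" "n \<ge> N" for m n
    proof -
      have "norm (poly_calc a (p m - p n)) \<le> e / 3 + e / 3"
      proof (rule norm_poly_calc_le[OF a])
        fix z assume z: "z \<in> spectrum a"
        have "cmod (poly (p m - p n) z) \<le> cmod (h z - poly (p n) z) + cmod (h z - poly (p m) z)"
          using norm_triangle_ineq4[of "h z - poly (p n) z" "h z - poly (p m) z"] by simp
        also have "\<dots> \<le> e / 3 + e / 3"
          using p[OF z, of n] p[OF z, of m] N[OF mn(1)] N[OF mn(2)] by linarith
        finally show "cmod (poly (p m - p n) z) \<le> e / 3 + e / 3" .
      qed
      with \<open>0 < e\<close> show ?thesis by (simp add: dist_norm poly_calc_diff)
    qed
    then show "\<exists>M. \<forall>m\<ge>M. \<forall>n\<ge>M. dist (poly_calc a (p m)) (poly_calc a (p n)) < e" by blast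
  qed
  then obtain x where "(\<lambda>n. poly_calc a (p n)) \<longlonglongrightarrow> x"
    using Cauchy_convergent convergentD by blast
  ultimately show ?thesis unfolding poly_limit_def by blast
qed

theorem functional_calculus_hom_exists:
  assumes a: "self_adjoint a"
  shows "\<exists>\<Phi>. functional_calculus_hom a \<Phi>"
proof
  define \<Phi> where "\<Phi> h = (THE x. poly_limit a h x)" for h
  have lim: "poly_limit a h (\<Phi> h)" if "continuous_on (spectrum a) h" for h
    unfolding \<Phi>_def
    by (rule theI') (use poly_limit_exists[OF a that] poly_limit_unique[OF a] in blast)
  have eqI: "\<Phi> h = x" if "poly_limit a h x" for h x
    unfolding \<Phi>_def by (rule the_equality) (use that poly_limit_unique[OF a] in blast)+
  show "functional_calculus_hom a \<Phi>"
    unfolding functional_calculus_hom_def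
  proof (intro conjI allI impI)
    fix h k :: "complex \<Rightarrow> complex"
    assume h: "continuous_on (spectrum a) h"
    show "\<Phi> (\<lambda>z. cnj (h z)) = star (\<Phi> h)"
      by (intro eqI poly_limit_cnj a lim h)
    show "\<Phi> (\<lambda>z. c * h z) = c *\<^sub>C \<Phi> h" for c
      by (intro eqI poly_limit_scaleC lim h)
    assume k: "continuous_on (spectrum a) k"
    show "\<Phi> (\<lambda>z. h z + k z) = \<Phi> h + \<Phi> k"
      by (intro eqI poly_limit_add lim h k)
    show "\<Phi> (\<lambda>z. h z * k z) = \<Phi> h * \<Phi> k"
      by (intro eqI poly_limit_mult lim h k)
    show "\<Phi> h = \<Phi> k" if "\<forall>z\<in>spectrum a. h z = k z"
      by (rule eqI) (use that lim[OF k] poly_limit_cong[of a h k] in blast)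
  next
    have "poly [:1:] = (\<lambda>z::complex. 1)" "poly [:0, 1:] = (\<lambda>z::complex. z)" by auto
    then show "\<Phi> (\<lambda>z. 1) = 1" "\<Phi> (\<lambda>z. z) = a"
      using poly_limit_poly[of a "[:1:]"] poly_limit_poly[of a "[:0, 1:]"]
      by (auto intro!: eqI simp: scaleC_one)
  qed
qed

section \<open>Properties of the functional calculus\<close>

text \<open>A self-adjoint element with a chosen calculus homomorphism. All facts below are derived from the
homomorphism properties alone, so that they hold for every choice; \<open>compose\<close> shows that the choice is
immaterial on continuous functions.\<close>

locale functional_calculus =
  fixes a :: "'a::unital_cstar_algebra" and \<Phi> :: "(complex \<Rightarrow> complex) \<Rightarrow> 'a"
  assumes a: "self_adjoint a" and hom: "functional_calculus_hom a \<Phi>"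
begin

lemma cong:
  assumes "continuous_on (spectrum a) h" "\<And>z. z \<in> spectrum a \<Longrightarrow> h z = k z"
  shows "\<Phi> h = \<Phi> k"
proof -
  have "continuous_on (spectrum a) k"
    using assms continuous_on_cong[of "spectrum a" "spectrum a" h k] by simp
  with assms hom show ?thesis unfolding functional_calculus_hom_def by blast
qed

lemma add: "continuous_on (spectrum a) h \<Longrightarrow> continuous_on (spectrum a) k \<Longrightarrow>
    \<Phi> (\<lambda>z. h z + k z) = \<Phi> h + \<Phi> k"
  using hom unfolding functional_calculus_hom_def by blast

lemma mult: "continuous_on (spectrum a) h \<Longrightarrow> continuous_on (spectrum a) k \<Longrightarrow>
    \<Phi> (\<lambda>z. h z * k z) = \<Phi> h * \<Phi> k"
  using hom unfolding functional_calculus_hom_def by blast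

lemma scale: "continuous_on (spectrum a) h \<Longrightarrow> \<Phi> (\<lambda>z. c * h z) = c *\<^sub>C \<Phi> h"
  using hom unfolding functional_calculus_hom_def by blast

lemma star: "continuous_on (spectrum a) h \<Longrightarrow> \<Phi> (\<lambda>z. cnj (h z)) = star (\<Phi> h)"
  using hom unfolding functional_calculus_hom_def by blast

lemma one: "\<Phi> (\<lambda>z. 1) = 1"
  using hom unfolding functional_calculus_hom_def by blast

lemma ident: "\<Phi> (\<lambda>z. z) = a"
  using hom unfolding functional_calculus_hom_def by blast

lemma const: "\<Phi> (\<lambda>z. c) = c *\<^sub>C 1"
  using scale[of "\<lambda>z. 1" c] one by simp

lemma diff:
  assumes "continuous_on (spectrum a) h" "continuous_on (spectrum a) k"
  shows "\<Phi> (\<lambda>z. h z - k z) = \<Phi> h - \<Phi> k"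
  using add[of h "\<lambda>z. - 1 * k z"] scale[of k "- 1"] assms
  by (simp add: continuous_on_minus scaleC_one)

lemma sum:
  assumes "finite T" "\<And>t. t \<in> T \<Longrightarrow> continuous_on (spectrum a) (h t)"
  shows "\<Phi> (\<lambda>z. \<Sum>t\<in>T. h t z) = (\<Sum>t\<in>T. \<Phi> (h t))"
  using assms
proof (induction T rule: finite_induct)
  case (insert t T)
  then show ?case using add[of "h t" "\<lambda>z. \<Sum>t\<in>T. h t z"] by (simp add: continuous_on_sum)
qed (use const[of 0] in simp)

lemma affine: "\<Phi> (\<lambda>z. c + d * z) = c *\<^sub>C 1 + d *\<^sub>C a"
  using add[of "\<lambda>z. c" "\<lambda>z. d * z"] scale[of "\<lambda>z. z" d] const ident
  by (simp add: continuous_on_id continuous_on_mult)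

lemma self_adjoint_real:
  assumes "continuous_on (spectrum a) h" "\<And>z. z \<in> spectrum a \<Longrightarrow> h z \<in> \<real>"
  shows "self_adjoint (\<Phi> h)"
  unfolding self_adjoint_def star[OF assms(1), symmetric]
  by (rule cong) (use assms in \<open>auto intro!: continuous_intros simp: Reals_cnj_iff\<close>)

lemma mult_inverse:
  assumes h: "continuous_on (spectrum a) h" "\<And>z. z \<in> spectrum a \<Longrightarrow> h z \<noteq> 0"
  shows "\<Phi> (\<lambda>z. inverse (h z)) * \<Phi> h = 1" "\<Phi> h * \<Phi> (\<lambda>z. inverse (h z)) = 1"
proof -
  have i: "continuous_on (spectrum a) (\<lambda>z. inverse (h z))"
    using h by (intro continuous_intros) auto
  have "\<Phi> (\<lambda>z. inverse (h z) * h z) = \<Phi> (\<lambda>z. 1)" "\<Phi> (\<lambda>z. h z * inverse (h z)) = \<Phi> (\<lambda>z. 1)"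
    using h i by (auto intro!: cong continuous_intros)
  then show "\<Phi> (\<lambda>z. inverse (h z)) * \<Phi> h = 1" "\<Phi> h * \<Phi> (\<lambda>z. inverse (h z)) = 1"
    using mult[OF i h(1)] mult[OF h(1) i] one by simp_all
qed

lemma spectrum_subset:
  assumes h: "continuous_on (spectrum a) h"
  shows "spectrum (\<Phi> h) \<subseteq> h ` spectrum a"
proof
  fix l assume l: "l \<in> spectrum (\<Phi> h)"
  show "l \<in> h ` spectrum a"
  proof (rule ccontr)
    assume "l \<notin> h ` spectrum a"
    then have "l - h z \<noteq> 0" if "z \<in> spectrum a" for z
      using that by auto
    moreover have "continuous_on (spectrum a) (\<lambda>z. l - h z)"
      using h by (intro continuous_intros)
    ultimately have "has_inverse (\<Phi> (\<lambda>z. l - h z))"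
      using has_inverseI[OF mult_inverse[of "\<lambda>z. l - h z"]] by blast
    then show False
      using l diff[of "\<lambda>z. l" h] h const by (simp add: spectrum_iff)
  qed
qed

lemma norm_le:
  assumes h: "continuous_on (spectrum a) h" and B: "\<And>z. z \<in> spectrum a \<Longrightarrow> cmod (h z) \<le> B"
  shows "norm (\<Phi> h) \<le> B"
proof -
  have c: "continuous_on (spectrum a) (\<lambda>z. cnj (h z) * h z)"
    using h by (intro continuous_intros)
  have eq: "star (\<Phi> h) * \<Phi> h = \<Phi> (\<lambda>z. cnj (h z) * h z)"
    using h star[OF h] mult[of "\<lambda>z. cnj (h z)" h] by (simp add: continuous_on_cnj)
  obtain l where "l \<in> spectrum (star (\<Phi> h) * \<Phi> h)" "cmod l = norm (star (\<Phi> h) * \<Phi> h)"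
    using norm_attained_in_spectrum[OF self_adjoint_star_mult[of "\<Phi> h"]] by blast
  then obtain z where z: "z \<in> spectrum a" "cmod (cnj (h z) * h z) = (norm (\<Phi> h))\<^sup>2"
    using spectrum_subset[OF c] unfolding eq[symmetric] norm_star_mult_self by blast
  then have "(norm (\<Phi> h))\<^sup>2 = (cmod (h z))\<^sup>2" by (simp add: norm_mult power2_eq_square)
  with B[OF z(1)] show ?thesis by simp
qed

lemma poly_calc_eq:
  assumes h: "continuous_on (spectrum a) h"
  shows "\<Phi> (\<lambda>z. poly p (h z)) = poly_calc (\<Phi> h) p"
proof (induction p)
  case 0
  show ?case using const[of 0] by simp
next
  case (pCons c p)
  have "continuous_on (spectrum a) (\<lambda>z. poly p (h z))" using h by (intro continuous_intros)
  then show ?case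
    using add[of "\<lambda>z. c" "\<lambda>z. h z * poly p (h z)"] mult[OF h, of "\<lambda>z. poly p (h z)"] h pCons const[of c]
    by (simp add: continuous_on_mult)
qed

text \<open>\<open>k(h(a)) = (k \<circ> h)(a)\<close>. The case \<open>h z = z\<close> is the uniqueness of the functional calculus. Continuity of
\<open>k\<close> is assumed on \<open>h ` spectrum a\<close>, which contains the spectrum of \<open>h(a)\<close> by \<open>spectrum_subset\<close>.\<close>

lemma compose:
  assumes h: "continuous_on (spectrum a) h" and re: "h ` spectrum a \<subseteq> \<real>"
    and \<Psi>: "functional_calculus_hom (\<Phi> h) \<Psi>" and k: "continuous_on (h ` spectrum a) k"
  shows "\<Psi> k = \<Phi> (\<lambda>z. k (h z))"
proof -
  interpret B: functional_calculus "\<Phi> h" \<Psi>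
    using \<Psi> self_adjoint_real[OF h] re by unfold_locales auto
  have sub: "spectrum (\<Phi> h) \<subseteq> h ` spectrum a" by (rule spectrum_subset[OF h])
  have kB: "continuous_on (spectrum (\<Phi> h)) k" using k sub by (rule continuous_on_subset)
  have kh: "continuous_on (spectrum a) (\<lambda>z. k (h z))"
    by (rule continuous_on_compose2[OF k h]) simp
  have "norm (\<Psi> k - \<Phi> (\<lambda>z. k (h z))) \<le> 0"
  proof (rule field_le_epsilon)
    fix e :: real assume "0 < e"
    then have e2: "0 < e / 2" by simp
    obtain p where p: "\<And>z. z \<in> h ` spectrum a \<Longrightarrow> cmod (k z - poly p z) < e / 2"
      using Stone_Weierstrass_complex_poly[OF compact_continuous_image[OF h compact_spectrum] re k e2]
      by blast
    have cp: "continuous_on (spectrum (\<Phi> h)) (poly p)" "continuous_on (spectrum a) (\<lambda>z. poly p (h z))"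
      using h by (auto intro!: continuous_intros)
    have "\<Psi> (poly p) = poly_calc (\<Phi> h) p"
      using B.poly_calc_eq[OF continuous_on_id, of p] B.ident by simp
    then have "\<Psi> (poly p) = \<Phi> (\<lambda>z. poly p (h z))"
      by (simp add: poly_calc_eq[OF h])
    then have "\<Psi> k - \<Phi> (\<lambda>z. k (h z)) = \<Psi> (\<lambda>z. k z - poly p z) - \<Phi> (\<lambda>z. k (h z) - poly p (h z))"
      using B.diff[OF kB cp(1)] diff[OF kh cp(2)] by simp
    also have "norm \<dots> \<le> norm (\<Psi> (\<lambda>z. k z - poly p z)) + norm (\<Phi> (\<lambda>z. k (h z) - poly p (h z)))"
      by (rule norm_triangle_ineq4)
    also have "norm (\<Psi> (\<lambda>z. k z - poly p z)) \<le> e / 2"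
      using p sub continuous_on_diff[OF kB cp(1)] by (intro B.norm_le) (auto simp: less_imp_le)
    also have "norm (\<Phi> (\<lambda>z. k (h z) - poly p (h z))) \<le> e / 2"
      using p continuous_on_diff[OF kh cp(2)] by (intro norm_le) (auto simp: less_imp_le)
    finally show "norm (\<Psi> k - \<Phi> (\<lambda>z. k (h z))) \<le> 0 + e" by simp
  qed
  then show ?thesis by simp
qed

lemma continuous_of_real_Re:
  assumes "spectrum a \<subseteq> complex_of_real ` S" "continuous_on S f"
  shows "continuous_on (spectrum a) (\<lambda>z. complex_of_real (f (Re z)))"
proof -
  have "Re ` spectrum a \<subseteq> S" using assms(1) by auto
  then show ?thesis
    by (intro continuous_intros continuous_on_compose2[OF assms(2)]) auto
qed

lemma cfc_eq:
  assumes "spectrum a \<subseteq> complex_of_real ` S" "continuous_on S f"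
  shows "cfc f a = \<Phi> (\<lambda>z. complex_of_real (f (Re z)))"
  unfolding cfc_def
proof (rule the_equality)
  fix b
  assume "\<exists>\<Psi>. functional_calculus_hom a \<Psi> \<and> b = \<Psi> (\<lambda>z. complex_of_real (f (Re z)))"
  then obtain \<Psi> where \<Psi>: "functional_calculus_hom a \<Psi>" "b = \<Psi> (\<lambda>z. complex_of_real (f (Re z)))" by blast
  then show "b = \<Phi> (\<lambda>z. complex_of_real (f (Re z)))"
    using compose[of "\<lambda>z. z" \<Psi>] spectrum_self_adjoint_subset_Reals[OF a] continuous_of_real_Re[OF assms]
    by (simp add: ident continuous_on_id)
qed (use hom in blast)

end

section \<open>The positive cone\<close>

lemma positive_iff_Re: "positive x \<longleftrightarrow> self_adjoint x \<and> (\<forall>l\<in>spectrum x. 0 \<le> Re l)"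
proof (cases "self_adjoint x")
  case True
  have "l \<in> complex_of_real ` {0..} \<longleftrightarrow> 0 \<le> Re l" if "l \<in> spectrum x" for l
  proof
    assume "0 \<le> Re l"
    then show "l \<in> complex_of_real ` {0..}"
      using spectrum_self_adjoint_eq(1)[OF True that] by (intro image_eqI[of _ _ "Re l"]) auto
  qed auto
  with True show ?thesis by (auto simp: positive_def)
qed (simp add: positive_def)

lemma spectrum_scaleC_one_diff: "l \<in> spectrum (c *\<^sub>C 1 - x) \<longleftrightarrow> c - l \<in> spectrum x"
proof -
  have eq: "(c - l) *\<^sub>C 1 - x = - (l *\<^sub>C 1 - (c *\<^sub>C 1 - x))"
    by (simp add: cvs.scale_left_diff_distrib)
  show ?thesis unfolding spectrum_iff eq
    using has_inverse_uminus[of "l *\<^sub>C 1 - (c *\<^sub>C 1 - x)"]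
      has_inverse_uminus[of "- (l *\<^sub>C 1 - (c *\<^sub>C 1 - x))"] by auto
qed

lemma self_adjoint_add: "self_adjoint x \<Longrightarrow> self_adjoint y \<Longrightarrow> self_adjoint (x + y)"
  by (simp add: self_adjoint_def star_add)

lemma self_adjoint_diff: "self_adjoint x \<Longrightarrow> self_adjoint y \<Longrightarrow> self_adjoint (x - y)"
  by (simp add: self_adjoint_def star_diff)

lemma self_adjoint_of_real: "self_adjoint (complex_of_real t *\<^sub>C 1)"
  by (simp add: self_adjoint_def star_scaleC)

lemma self_adjoint_scaleC: "self_adjoint x \<Longrightarrow> self_adjoint (complex_of_real t *\<^sub>C x)"
  by (simp add: self_adjoint_def star_scaleC)

text \<open>This lemma and its converse \<open>positive_imp_norm_le\<close> describe positivity by a norm inequality, which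
makes it evident that the positive elements form a closed convex cone.\<close>

lemma norm_le_imp_positive:
  assumes x: "self_adjoint x" and n: "norm (complex_of_real t *\<^sub>C 1 - x) \<le> t"
  shows "positive x"
  unfolding positive_iff_Re
proof (intro conjI ballI x)
  fix l assume "l \<in> spectrum x"
  then have "complex_of_real t - l \<in> spectrum (complex_of_real t *\<^sub>C 1 - x)"
    by (simp add: spectrum_scaleC_one_diff)
  then have "cmod (complex_of_real t - l) \<le> t"
    using spectrum_norm_le n order_trans by blast
  then show "0 \<le> Re l"
    using abs_Re_le_cmod[of "complex_of_real t - l"] by simp
qed

lemma positive_imp_norm_le:
  assumes x: "positive x" and t: "norm x \<le> t"
  shows "norm (complex_of_real t *\<^sub>C 1 - x) \<le> t"
proof -
  have sx: "self_adjoint x" using x by (simp add: positive_iff_Re)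
  then obtain l where l: "l \<in> spectrum (complex_of_real t *\<^sub>C 1 - x)"
      "cmod l = norm (complex_of_real t *\<^sub>C 1 - x)"
    using norm_attained_in_spectrum[OF self_adjoint_diff[OF self_adjoint_of_real]] by blast
  define k where "k = complex_of_real t - l"
  have k: "k \<in> spectrum x" using l(1) by (simp add: spectrum_scaleC_one_diff k_def)
  have "l = complex_of_real (t - Re k)"
    using spectrum_self_adjoint_eq(1)[OF sx k] by (simp add: k_def algebra_simps)
  then have "cmod l = \<bar>t - Re k\<bar>" by (simp only: norm_of_real)
  moreover have "0 \<le> Re k" using x k by (simp add: positive_iff_Re)
  moreover have "Re k \<le> t"
    using spectrum_norm_le[OF k] t abs_Re_le_cmod[of k] by linarith
  ultimately show ?thesis using l(2) by linarith
qed

lemma positive_add: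
  assumes "positive x" "positive y"
  shows "positive (x + y)"
proof (rule norm_le_imp_positive)
  show "self_adjoint (x + y)" using assms by (simp add: positive_def self_adjoint_add)
  have "complex_of_real (norm x + norm y) *\<^sub>C 1 - (x + y) =
    (complex_of_real (norm x) *\<^sub>C 1 - x) + (complex_of_real (norm y) *\<^sub>C 1 - y)"
    by (simp add: scaleC_add_left)
  also have "norm \<dots> \<le> norm x + norm y"
    by (intro norm_triangle_le add_mono positive_imp_norm_le assms order_refl)
  finally show "norm (complex_of_real (norm x + norm y) *\<^sub>C 1 - (x + y)) \<le> norm x + norm y" .
qed

lemma positive_scaleC:
  assumes x: "positive x" and t: "0 \<le> t"
  shows "positive (complex_of_real t *\<^sub>C x)"
proof (rule norm_le_imp_positive)
  show "self_adjoint (complex_of_real t *\<^sub>C x)" using x by (simp add: positive_def self_adjoint_scaleC)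
  have "complex_of_real (t * norm x) *\<^sub>C 1 - complex_of_real t *\<^sub>C x =
      complex_of_real t *\<^sub>C (complex_of_real (norm x) *\<^sub>C 1 - x)"
    by (simp add: cvs.scale_right_diff_distrib scaleC_scaleC)
  also have "norm \<dots> \<le> t * norm x"
    using positive_imp_norm_le[OF x order_refl] t by (simp add: norm_scaleC mult_left_mono)
  finally show "norm (complex_of_real (t * norm x) *\<^sub>C 1 - complex_of_real t *\<^sub>C x) \<le> t * norm x" .
qed

lemma positive_zero: "positive (0::'a::unital_cstar_algebra)"
  by (rule norm_le_imp_positive[of _ 0]) (simp_all add: self_adjoint_def)

lemma positive_sum: "finite T \<Longrightarrow> (\<And>t. t \<in> T \<Longrightarrow> positive (x t)) \<Longrightarrow> positive (\<Sum>t\<in>T. x t)"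
  by (induction T rule: finite_induct) (simp_all add: positive_zero positive_add)

lemma positive_one: "positive (1::'a::unital_cstar_algebra)"
  by (rule norm_le_imp_positive[of _ 1]) (simp_all add: self_adjoint_def scaleC_one)

lemma positive_limit:
  assumes x: "\<And>n. positive (x n)" and lim: "x \<longlonglongrightarrow> (l::'a::unital_cstar_algebra)"
  shows "positive l"
proof -
  have "(\<lambda>n. star (x n)) \<longlonglongrightarrow> star l" using lim by (rule tendsto_star)
  moreover have "(\<lambda>n. star (x n)) = x" using x by (auto simp: positive_def self_adjoint_def)
  ultimately have sa: "self_adjoint l" using lim LIMSEQ_unique by (simp add: self_adjoint_def) blast
  have "Bseq x" using lim convergentI convergent_imp_Bseq by blast
  then obtain t where t: "\<And>n. norm (x n) \<le> t" unfolding Bseq_def by blast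
  have "(\<lambda>n. norm (complex_of_real t *\<^sub>C 1 - x n)) \<longlonglongrightarrow> norm (complex_of_real t *\<^sub>C 1 - l)"
    by (intro tendsto_intros lim)
  then have "norm (complex_of_real t *\<^sub>C 1 - l) \<le> t"
    by (rule LIMSEQ_le_const2) (use positive_imp_norm_le[OF x t] in blast)
  with sa show ?thesis by (rule norm_le_imp_positive)
qed

lemma positive_epsilon:
  assumes "\<And>e. 0 < e \<Longrightarrow> positive (x + complex_of_real e *\<^sub>C y)"
  shows "positive (x::'a::unital_cstar_algebra)"
proof (rule positive_limit)
  show "positive (x + complex_of_real (inverse (real (Suc n))) *\<^sub>C y)" for n
    by (rule assms) simp
  have "(\<lambda>n. x + inverse (real (Suc n)) *\<^sub>R y) \<longlonglongrightarrow> x + 0 *\<^sub>R y"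
    by (intro tendsto_intros LIMSEQ_inverse_real_of_nat)
  then show "(\<lambda>n. x + complex_of_real (inverse (real (Suc n))) *\<^sub>C y) \<longlonglongrightarrow> x"
    by (simp add: scaleR_scaleC)
qed

lemma (in functional_calculus) positive_fc:
  assumes h: "continuous_on (spectrum a) h"
    and "\<And>z. z \<in> spectrum a \<Longrightarrow> h z \<in> \<real> \<and> 0 \<le> Re (h z)"
  shows "positive (\<Phi> h)"
  unfolding positive_iff_Re
  using self_adjoint_real[OF h] spectrum_subset[OF h] assms by blast

section \<open>Positive maps and supporting lines\<close>

lemma clinear_rules:
  assumes "clinear \<phi>"
  shows "\<phi> (x + y) = \<phi> x + \<phi> y" "\<phi> (x - y) = \<phi> x - \<phi> y" "\<phi> (c *\<^sub>C x) = c *\<^sub>C \<phi> x"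
    "\<phi> (sum f T) = (\<Sum>t\<in>T. \<phi> (f t))"
proof -
  interpret L: Vector_Spaces.linear scaleC scaleC \<phi> by (rule assms)
  show "\<phi> (x + y) = \<phi> x + \<phi> y" "\<phi> (x - y) = \<phi> x - \<phi> y" "\<phi> (c *\<^sub>C x) = c *\<^sub>C \<phi> x"
    "\<phi> (sum f T) = (\<Sum>t\<in>T. \<phi> (f t))"
    by (rule L.add L.diff L.scale L.sum)+
qed

lemma positive_map_self_adjoint:
  assumes \<phi>: "positive_map \<phi>" and x: "self_adjoint x"
  shows "self_adjoint (\<phi> x)"
proof -
  have L: "clinear \<phi>" and P: "\<And>x. positive x \<Longrightarrow> positive (\<phi> x)"
    using \<phi> by (simp_all add: positive_map_def)
  let ?t = "complex_of_real (norm x)"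
  have "positive (x + ?t *\<^sub>C 1)"
    by (rule norm_le_imp_positive[of _ "norm x"]) (simp_all add: self_adjoint_add self_adjoint_of_real x)
  moreover have "positive (?t *\<^sub>C (1 :: 'a))"
    by (rule positive_scaleC[OF positive_one]) simp
  ultimately have "self_adjoint (\<phi> (x + ?t *\<^sub>C 1) - \<phi> (?t *\<^sub>C 1))"
    using P by (intro self_adjoint_diff) (auto simp: positive_def)
  moreover have "\<phi> (x + ?t *\<^sub>C 1) - \<phi> (?t *\<^sub>C 1) = \<phi> x"
    by (simp add: clinear_rules[OF L])
  ultimately show ?thesis by simp
qed

lemma positive_minus_const_iff:
  assumes "self_adjoint x"
  shows "positive (x - complex_of_real m *\<^sub>C 1) \<longleftrightarrow> (\<forall>l\<in>spectrum x. m \<le> Re l)"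
proof -
  have eq: "l \<in> spectrum (x - complex_of_real m *\<^sub>C 1) \<longleftrightarrow> l + complex_of_real m \<in> spectrum x" for l
    by (simp add: spectrum_iff scaleC_add_left algebra_simps)
  have "(\<forall>l\<in>spectrum (x - complex_of_real m *\<^sub>C 1). 0 \<le> Re l) \<longleftrightarrow> (\<forall>l\<in>spectrum x. m \<le> Re l)"
  proof safe
    fix l assume *: "\<forall>l\<in>spectrum (x - complex_of_real m *\<^sub>C 1). 0 \<le> Re l" "l \<in> spectrum x"
    then have "l - complex_of_real m \<in> spectrum (x - complex_of_real m *\<^sub>C 1)" by (simp add: eq)
    with * show "m \<le> Re l" by fastforce
  next
    fix l assume *: "\<forall>l\<in>spectrum x. m \<le> Re l" "l \<in> spectrum (x - complex_of_real m *\<^sub>C 1)"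
    then show "0 \<le> Re l" unfolding eq by fastforce
  qed
  then show ?thesis
    by (simp add: positive_iff_Re self_adjoint_diff self_adjoint_of_real assms)
qed

lemma positive_const_minus_iff:
  assumes "self_adjoint x"
  shows "positive (complex_of_real m *\<^sub>C 1 - x) \<longleftrightarrow> (\<forall>l\<in>spectrum x. Re l \<le> m)"
proof -
  have "(\<forall>l\<in>spectrum (complex_of_real m *\<^sub>C 1 - x). 0 \<le> Re l) \<longleftrightarrow> (\<forall>l\<in>spectrum x. Re l \<le> m)"
  proof safe
    fix l assume *: "\<forall>l\<in>spectrum (complex_of_real m *\<^sub>C 1 - x). 0 \<le> Re l" "l \<in> spectrum x"
    then have "complex_of_real m - l \<in> spectrum (complex_of_real m *\<^sub>C 1 - x)"
      by (simp add: spectrum_scaleC_one_diff)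
    with * show "Re l \<le> m" by fastforce
  next
    fix l assume *: "\<forall>l\<in>spectrum x. Re l \<le> m" "l \<in> spectrum (complex_of_real m *\<^sub>C 1 - x)"
    then show "0 \<le> Re l" unfolding spectrum_scaleC_one_diff by fastforce
  qed
  then show ?thesis
    by (simp add: positive_iff_Re self_adjoint_diff self_adjoint_of_real assms)
qed

text \<open>The least and greatest spectral values \<open>m, M \<in> I\<close> of \<open>a\<close> satisfy \<open>m \<le> a \<le> M\<close>, hence \<open>m \<le> \<phi> a \<le> M\<close>.\<close>

lemma spectrum_positive_unital_map:
  assumes \<phi>: "positive_map \<phi>" "\<phi> 1 = 1" and a: "self_adjoint a"
    and I: "is_interval I" "spectrum a \<subseteq> complex_of_real ` I"
  shows "spectrum (\<phi> a) \<subseteq> complex_of_real ` I"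
proof
  have L: "clinear \<phi>" and P: "\<And>x. positive x \<Longrightarrow> positive (\<phi> x)"
    using \<phi> by (simp_all add: positive_map_def)
  have b: "self_adjoint (\<phi> a)" by (rule positive_map_self_adjoint[OF \<phi>(1) a])
  have S: "compact (Re ` spectrum a)" "Re ` spectrum a \<noteq> {}"
    using spectrum_nonempty_self_adjoint[OF a]
    by (auto intro!: compact_continuous_image compact_spectrum continuous_intros)
  obtain m where m: "m \<in> Re ` spectrum a" "\<forall>l\<in>spectrum a. m \<le> Re l"
    using compact_attains_inf[OF S] by blast
  obtain M where M: "M \<in> Re ` spectrum a" "\<forall>l\<in>spectrum a. Re l \<le> M"
    using compact_attains_sup[OF S] by blast
  have "m \<in> I" "M \<in> I" using m M I by auto
  have "positive (\<phi> (a - complex_of_real m *\<^sub>C 1))" "positive (\<phi> (complex_of_real M *\<^sub>C 1 - a))"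
    using m M by (auto intro!: P simp: positive_minus_const_iff[OF a] positive_const_minus_iff[OF a])
  then have b': "\<forall>l\<in>spectrum (\<phi> a). m \<le> Re l" "\<forall>l\<in>spectrum (\<phi> a). Re l \<le> M"
    by (simp_all add: clinear_rules[OF L] \<phi> positive_minus_const_iff[OF b] positive_const_minus_iff[OF b])
  fix l assume l: "l \<in> spectrum (\<phi> a)"
  then have "Re l \<in> I"
    using mem_is_interval_1_I[OF I(1) \<open>m \<in> I\<close> \<open>M \<in> I\<close>] b' by blast
  then show "l \<in> complex_of_real ` I"
    using spectrum_self_adjoint_eq(1)[OF b l] by blast
qed

lemma convex_on_supporting_line:
  fixes f :: "real \<Rightarrow> real"
  assumes "open I" "convex_on I f" "x \<in> I"
  obtains c where "\<And>y. y \<in> I \<Longrightarrow> f x + c * (y - x) \<le> f y"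
  using convex_le_Inf_differential[OF assms(2)] assms by (metis interior_open)

lemma mono_supporting_slope_nonneg:
  fixes g :: "real \<Rightarrow> real"
  assumes J: "open J" "mono_on J g" "x \<in> J" and c: "\<And>y. y \<in> J \<Longrightarrow> g x + c * (y - x) \<le> g y"
  shows "0 \<le> c"
proof -
  obtain e where e: "e > 0" "ball x e \<subseteq> J" using J openE by blast
  then have y: "x - e / 2 \<in> J" by (auto simp: dist_real_def)
  have "g x + c * (- (e / 2)) \<le> g x"
    using c[OF y] mono_onD[OF J(2) y J(3)] e by simp
  with e show ?thesis by (simp add: zero_le_mult_iff)
qed

section \<open>Weights from the centralizer\<close>

lemma centralizer_closed_under:
  assumes "clinear E"
  shows "(1::'b::unital_cstar_algebra) \<in> centralizer E"
    "x \<in> centralizer E \<Longrightarrow> y \<in> centralizer E \<Longrightarrow> x + y \<in> centralizer E"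
    "x \<in> centralizer E \<Longrightarrow> c *\<^sub>C x \<in> centralizer E"
    "x \<in> centralizer E \<Longrightarrow> y \<in> centralizer E \<Longrightarrow> x * y \<in> centralizer E"
proof -
  show "x * y \<in> centralizer E" if "x \<in> centralizer E" "y \<in> centralizer E"
    using that unfolding centralizer_def by (simp add: mult.assoc)
qed (simp_all add: centralizer_def distrib_left distrib_right mult_scaleC_left mult_scaleC_right
      clinear_rules[OF assms])

lemma poly_calc_in_centralizer:
  assumes "clinear E" "b \<in> centralizer E"
  shows "poly_calc b p \<in> centralizer E"
proof (induction p)
  case 0
  then show ?case using centralizer_closed_under(3)[OF assms, of 0] by simp
qed (simp add: centralizer_closed_under assms)

lemma closed_centralizer:
  assumes "bounded_linear E"
  shows "closed (centralizer (E :: 'b::unital_cstar_algebra \<Rightarrow> 'b))"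
proof -
  have "centralizer E = (\<Inter>x. {b. E (b * x) = E (x * b)})" by (auto simp: centralizer_def)
  also have "closed \<dots>"
  proof (intro closed_INT ballI closed_Collect_eq)
    fix x
    show "continuous_on UNIV (\<lambda>b. E (b * x))" "continuous_on UNIV (\<lambda>b. E (x * b))"
      by (intro bounded_linear.continuous_on[OF assms] continuous_intros)+
  qed
  finally show ?thesis .
qed

context functional_calculus
begin

lemma mem_closed:
  assumes S: "closed S" "\<And>p. poly_calc a p \<in> S" and h: "continuous_on (spectrum a) h"
  shows "\<Phi> h \<in> S"
proof -
  have "\<exists>y\<in>S. dist y (\<Phi> h) < e" if "0 < e" for e
  proof -
    have e2: "0 < e / 2" using that by simp
    obtain p where p: "\<And>z. z \<in> spectrum a \<Longrightarrow> cmod (h z - poly p z) < e / 2"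
      using Stone_Weierstrass_complex_poly[OF compact_spectrum spectrum_self_adjoint_subset_Reals[OF a] h e2]
      by blast
    have cp: "continuous_on (spectrum a) (poly p)" by (intro continuous_intros)
    have "\<Phi> (poly p) = poly_calc a p"
      using poly_calc_eq[OF continuous_on_id, of p] by (simp add: ident)
    then have "norm (\<Phi> h - poly_calc a p) \<le> e / 2"
      using norm_le[OF continuous_on_diff[OF h cp], of "e / 2"] p diff[OF h cp] by (simp add: less_imp_le)
    with that S(2)[of p] show ?thesis by (force simp: dist_norm norm_minus_commute)
  qed
  then have "\<Phi> h \<in> closure S" by (simp add: closure_approachable)
  with S(1) show ?thesis by simp
qed

text \<open>Write \<open>p = k(a)\<close> and \<open>q = p\<^sup>-\<^sup>1\<close>. For \<open>r > 0\<close>, \<open>p x p + r = p (x + r q\<^sup>2) p\<close>, and the middle factor is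
invertible because \<open>x \<ge> 0\<close> and \<open>q\<^sup>2\<close> is bounded below by a positive constant. Hence \<open>- r\<close> is not in the
spectrum of \<open>p x p\<close>.\<close>

lemma positive_sandwich:
  fixes k :: "complex \<Rightarrow> real"
  assumes k: "continuous_on (spectrum a) k" "\<And>z. z \<in> spectrum a \<Longrightarrow> 0 < k z" and x: "positive x"
  shows "positive (\<Phi> (\<lambda>z. complex_of_real (k z)) * x * \<Phi> (\<lambda>z. complex_of_real (k z)))"
proof -
  define p where "p = \<Phi> (\<lambda>z. complex_of_real (k z))"
  define q where "q = \<Phi> (\<lambda>z. inverse (complex_of_real (k z)))"
  have kc: "continuous_on (spectrum a) (\<lambda>z. complex_of_real (k z))"
    using k by (intro continuous_intros)
  have k0: "k z \<noteq> 0" if "z \<in> spectrum a" for z using k(2)[OF that] by simp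
  have pq: "q * p = 1" "p * q = 1"
    using mult_inverse[OF kc] k0 by (auto simp: p_def q_def)
  have p: "star p = p"
    using self_adjoint_real[OF kc] by (simp add: p_def self_adjoint_def)
  have ki: "continuous_on (spectrum a) (\<lambda>z. inverse (complex_of_real (k z)))"
    using k0 by (intro continuous_intros k) auto
  obtain K where K: "K > 0" "\<And>z. z \<in> spectrum a \<Longrightarrow> k z \<le> K"
    using bounded_continuous_image_spectrum[OF k(1)] by (force simp: bounded_pos)
  define c where "c = inverse K * inverse K"
  have c: "c > 0" using K by (simp add: c_def)
  have qq: "positive (q * q - complex_of_real c *\<^sub>C 1)"
  proof -
    have "q * q - complex_of_real c *\<^sub>C 1 =
        \<Phi> (\<lambda>z. inverse (complex_of_real (k z)) * inverse (complex_of_real (k z)) - complex_of_real c)"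
      using diff[OF continuous_on_mult[OF ki ki] continuous_on_const[of _ "complex_of_real c"]] mult[OF ki ki]
      by (simp add: const q_def)
    moreover have "c \<le> inverse (k z) * inverse (k z)" if z: "z \<in> spectrum a" for z
      unfolding c_def using K k(2)[OF z] z by (intro mult_mono le_imp_inverse_le) auto
    then have "positive (\<Phi> (\<lambda>z. inverse (complex_of_real (k z)) * inverse (complex_of_real (k z)) - complex_of_real c))"
      using continuous_on_diff[OF continuous_on_mult[OF ki ki] continuous_on_const[of _ "complex_of_real c"]]
      by (intro positive_fc) (auto simp flip: of_real_inverse of_real_mult of_real_diff)
    ultimately show ?thesis by simp
  qed
  have sx: "self_adjoint x" using x by (simp add: positive_def)
  have sa: "self_adjoint (p * x * p)"
    using sx p by (simp add: self_adjoint_def star_mult mult.assoc)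
  have "0 \<le> Re l" if l: "l \<in> spectrum (p * x * p)" for l
  proof (rule ccontr)
    assume "\<not> 0 \<le> Re l"
    then have neg: "- Re l > 0" by simp
    define y where "y = x + complex_of_real (- Re l) *\<^sub>C (q * q)"
    have eq: "y - complex_of_real (- Re l * c) *\<^sub>C 1 =
        x + complex_of_real (- Re l) *\<^sub>C (q * q - complex_of_real c *\<^sub>C 1)"
      by (simp add: y_def cvs.scale_right_diff_distrib scaleC_scaleC)
    have pos: "positive (y - complex_of_real (- Re l * c) *\<^sub>C 1)"
      unfolding eq using neg by (intro positive_add x positive_scaleC qq) simp
    have "self_adjoint (q * q - complex_of_real c *\<^sub>C 1 + complex_of_real c *\<^sub>C 1)"
      using qq by (intro self_adjoint_add self_adjoint_of_real) (simp add: positive_def)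
    then have sy: "self_adjoint y"
      unfolding y_def by (intro self_adjoint_add sx self_adjoint_scaleC) simp
    have "\<forall>m\<in>spectrum y. - Re l * c \<le> Re m"
      using pos positive_minus_const_iff[OF sy] by blast
    moreover have "- Re l * c > 0" using neg c by (intro mult_pos_pos)
    ultimately have "0 \<notin> spectrum y" by fastforce
    then have "has_inverse (- y)" by (simp add: spectrum_iff)
    moreover have "has_inverse p" using pq by (rule has_inverseI)
    ultimately have "has_inverse (p * (- y) * p)" by (intro has_inverse_mult)
    moreover have "p * (- y) * p = l *\<^sub>C 1 - p * x * p"
    proof -
      have "p * (q * q) * p = 1" using pq by (metis mult.assoc mult_1_right)
      then have "p * y * p = p * x * p + complex_of_real (- Re l) *\<^sub>C 1"
        by (simp only: y_def distrib_left distrib_right mult_scaleC_left mult_scaleC_right)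
      moreover have "complex_of_real (- Re l) *\<^sub>C 1 = - (l *\<^sub>C (1::'a))"
        by (subst (2) spectrum_self_adjoint_eq(1)[OF sa l]) simp
      ultimately show ?thesis by simp
    qed
    ultimately show False using l by (simp add: spectrum_iff)
  qed
  with sa show ?thesis by (simp add: positive_iff_Re p_def)
qed

text \<open>The square root is taken of \<open>w + e\<close> instead of \<open>w\<close>, to have a strictly positive function; then \<open>e \<rightarrow> 0\<close>.\<close>

lemma positive_weighted_expectation:
  fixes E :: "'a \<Rightarrow> 'a" and w :: "complex \<Rightarrow> real"
  assumes E: "positive_map E" "bounded_linear E" and aE: "a \<in> centralizer E"
    and w: "continuous_on (spectrum a) w" "\<And>z. z \<in> spectrum a \<Longrightarrow> 0 \<le> w z" and x: "positive x"
  shows "positive (E (\<Phi> (\<lambda>z. complex_of_real (w z)) * x))"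
proof (rule positive_epsilon[where y = "E x"])
  have L: "clinear E" and P: "\<And>x. positive x \<Longrightarrow> positive (E x)"
    using E by (simp_all add: positive_map_def)
  fix e :: real assume e: "0 < e"
  define k where "k z = sqrt (w z + e)" for z
  define p where "p = \<Phi> (\<lambda>z. complex_of_real (k z))"
  have k: "continuous_on (spectrum a) k" "\<And>z. z \<in> spectrum a \<Longrightarrow> 0 < k z"
    using w e by (auto simp: k_def intro!: continuous_intros add_nonneg_pos)
  have kc: "continuous_on (spectrum a) (\<lambda>z. complex_of_real (k z))"
      "continuous_on (spectrum a) (\<lambda>z. complex_of_real (w z))"
    using k w by (auto intro!: continuous_intros)
  have "p * p = \<Phi> (\<lambda>z. complex_of_real (k z) * complex_of_real (k z))"
    unfolding p_def by (rule mult[OF kc(1) kc(1), symmetric])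
  also have "\<dots> = \<Phi> (\<lambda>z. complex_of_real (w z) + complex_of_real e)"
    by (rule cong[OF continuous_on_mult[OF kc(1) kc(1)]])
       (use w(2) e in \<open>simp add: k_def flip: of_real_mult of_real_add\<close>)
  also have "\<dots> = \<Phi> (\<lambda>z. complex_of_real (w z)) + complex_of_real e *\<^sub>C 1"
    using add[OF kc(2) continuous_on_const[of _ "complex_of_real e"]] by (simp add: const)
  finally have pp: "p * p = \<Phi> (\<lambda>z. complex_of_real (w z)) + complex_of_real e *\<^sub>C 1" .
  have "p \<in> centralizer E"
    unfolding p_def by (intro mem_closed closed_centralizer E poly_calc_in_centralizer L aE kc)
  then have "E (p * (p * x)) = E ((p * x) * p)" by (simp add: centralizer_def)
  then have "positive (E (p * p * x))"
    using P[OF positive_sandwich[OF k x]] by (simp add: p_def mult.assoc)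
  then show "positive (E (\<Phi> (\<lambda>z. complex_of_real (w z)) * x) + complex_of_real e *\<^sub>C E x)"
    by (simp add: pp distrib_right mult_scaleC_left clinear_rules[OF L])
qed

end

section \<open>Jensen's inequality under the expectation\<close>

context functional_calculus
begin

lemma positive_cfc_minus_affine:
  assumes "spectrum a \<subseteq> complex_of_real ` S" "continuous_on S f"
    and le: "\<And>s. s \<in> S \<Longrightarrow> c + d * s \<le> f s"
  shows "positive (cfc f a - (complex_of_real c *\<^sub>C 1 + complex_of_real d *\<^sub>C a))"
proof -
  have fc: "continuous_on (spectrum a) (\<lambda>z. complex_of_real (f (Re z)))"
    by (rule continuous_of_real_Re[OF assms(1,2)])
  have ac: "continuous_on (spectrum a) (\<lambda>z. complex_of_real c + complex_of_real d * z)"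
    by (intro continuous_intros)
  have "complex_of_real (f (Re z)) - (complex_of_real c + complex_of_real d * z) \<in> \<real> \<and>
      0 \<le> Re (complex_of_real (f (Re z)) - (complex_of_real c + complex_of_real d * z))"
    if z: "z \<in> spectrum a" for z
  proof -
    obtain s where "s \<in> S" "z = complex_of_real s" using z assms(1) by blast
    then show ?thesis using le[of s] by (auto simp flip: of_real_mult of_real_add of_real_diff)
  qed
  then have "positive (\<Phi> (\<lambda>z. complex_of_real (f (Re z)) - (complex_of_real c + complex_of_real d * z)))"
    by (intro positive_fc continuous_on_diff fc ac) blast
  then show ?thesis
    by (simp add: diff[OF fc ac] affine cfc_eq[OF assms(1,2)])
qed

text \<open>If \<open>x\<close> dominates \<open>l\<^sub>t(a)\<close> for affine functions \<open>l\<^sub>t\<close> with \<open>l\<^sub>t(t) = h t\<close>, one for each \<open>t \<in> S\<close>, then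
\<open>E x\<close> dominates \<open>E (h(a))\<close>. The \<open>l\<^sub>t\<close> need not lie below \<open>h\<close>: only the values of \<open>l\<^sub>t\<close> near \<open>t\<close> matter.\<close>

lemma expectation_ge_cfc:
  fixes E :: "'a \<Rightarrow> 'a"
  assumes E: "positive_map E" "bounded_linear E" and aE: "a \<in> centralizer E"
    and S: "spectrum a \<subseteq> complex_of_real ` S" "continuous_on S h"
    and minorant: "\<And>t. t \<in> S \<Longrightarrow> \<exists>c d. c + d * t = h t \<and>
      positive (x - (complex_of_real c *\<^sub>C 1 + complex_of_real d *\<^sub>C a))"
  shows "positive (E x - E (cfc h a))"
proof (rule positive_epsilon[where y = "E 1"])
  have L: "clinear E" and P: "\<And>x. positive x \<Longrightarrow> positive (E x)"
    using E by (simp_all add: positive_map_def)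
  fix e :: real assume e: "0 < e"
  obtain c d where cd: "\<And>t. t \<in> S \<Longrightarrow> c t + d t * t = h t"
      "\<And>t. t \<in> S \<Longrightarrow> positive (x - (complex_of_real (c t) *\<^sub>C 1 + complex_of_real (d t) *\<^sub>C a))"
    using minorant by metis
  have Re_S: "Re z \<in> S \<and> z = complex_of_real (Re z)" if "z \<in> spectrum a" for z
    using that S(1) by auto
  have hc: "continuous_on (spectrum a) (\<lambda>z. h (Re z))"
    by (rule continuous_on_compose2[OF S(2)]) (use Re_S in \<open>auto intro!: continuous_intros\<close>)
  define l where "l t z = c t + d t * Re z" for t z
  \<comment> \<open>unnormalized weight: positive at \<open>t\<close>, and zero wherever \<open>l t\<close> falls below \<open>h - e\<close>\<close>
  define u where "u t z = max 0 (l t z - h (Re z) + e)" for t z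
  have lc: "continuous_on (spectrum a) (l t)" for t
    unfolding l_def by (intro continuous_intros)
  have uc: "continuous_on (spectrum a) (u t)" for t
    unfolding u_def by (intro continuous_intros lc hc)
  have u0: "0 \<le> u t z" for t z by (simp add: u_def)
  have "\<exists>A. open A \<and> A \<inter> spectrum a = u t -` {0<..} \<inter> spectrum a" for t
    using uc[of t] open_greaterThan[of "0::real"] unfolding continuous_on_open_invariant by blast
  then obtain A where A: "\<And>t. open (A t)" "\<And>t. A t \<inter> spectrum a = u t -` {0<..} \<inter> spectrum a"
    by metis
  have "spectrum a \<subseteq> (\<Union>t\<in>Re ` spectrum a. A t)"
  proof
    fix z assume z: "z \<in> spectrum a"
    have "u (Re z) z = e" using cd(1)[of "Re z"] Re_S[OF z] e by (simp add: u_def l_def)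
    then have "z \<in> A (Re z)" using A(2)[of "Re z"] z e by auto
    with z show "z \<in> (\<Union>t\<in>Re ` spectrum a. A t)" by blast
  qed
  then obtain T where T: "T \<subseteq> Re ` spectrum a" "finite T" "spectrum a \<subseteq> (\<Union>t\<in>T. A t)"
    using compactE_image[OF compact_spectrum, of "Re ` spectrum a" A] A(1) by metis
  have TS: "t \<in> S" if "t \<in> T" for t using that T(1) Re_S by auto
  \<comment> \<open>finitely many of the weights cover the spectrum, so they can be normalized\<close>
  define U where "U z = (\<Sum>t\<in>T. u t z)" for z
  have U: "0 < U z" if z: "z \<in> spectrum a" for z
  proof -
    obtain t where t: "t \<in> T" "0 < u t z" using T(3) A(2) z by blast
    then show ?thesis unfolding U_def using T(2) u0 by (intro sum_pos2[of T t]) auto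
  qed
  define w where "w t z = u t z / U z" for t z
  have wc: "continuous_on (spectrum a) (w t)" for t
    unfolding w_def U_def
    by (intro continuous_intros uc) (use U in \<open>fastforce simp: U_def\<close>)
  have w0: "0 \<le> w t z" if "z \<in> spectrum a" for t z
    using U[OF that] u0[of t z] by (simp add: w_def)
  have w1: "(\<Sum>t\<in>T. w t z) = 1" if "z \<in> spectrum a" for z
    using U[OF that] by (simp add: w_def U_def flip: sum_divide_distrib)
  have wcc: "continuous_on (spectrum a) (\<lambda>z. complex_of_real (w t z))" for t
    using wc by (intro continuous_intros)
  have lcc: "continuous_on (spectrum a) (\<lambda>z. complex_of_real (l t z))" for t
    using lc by (intro continuous_intros)
  have la: "\<Phi> (\<lambda>z. complex_of_real (l t z)) = complex_of_real (c t) *\<^sub>C 1 + complex_of_real (d t) *\<^sub>C a" for t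
    unfolding affine[symmetric] by (rule cong[OF lcc]) (use Re_S in \<open>force simp: l_def\<close>)
  define m where "m z = (\<Sum>t\<in>T. w t z * l t z)" for z
  have mc: "continuous_on (spectrum a) (\<lambda>z. complex_of_real (m z))"
    unfolding m_def using wc lc by (intro continuous_intros)
  have sum_w: "(\<Sum>t\<in>T. \<Phi> (\<lambda>z. complex_of_real (w t z))) = 1"
  proof -
    have "(\<Sum>t\<in>T. \<Phi> (\<lambda>z. complex_of_real (w t z))) = \<Phi> (\<lambda>z. \<Sum>t\<in>T. complex_of_real (w t z))"
      by (rule sum[symmetric]) (use T wcc in auto)
    also have "\<dots> = \<Phi> (\<lambda>z. 1)"
      by (rule cong) (use w1 wcc in \<open>auto intro!: continuous_intros simp flip: of_real_sum\<close>)
    finally show ?thesis by (simp add: one)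
  qed
  have sum_wl: "(\<Sum>t\<in>T. \<Phi> (\<lambda>z. complex_of_real (w t z)) * \<Phi> (\<lambda>z. complex_of_real (l t z))) =
      \<Phi> (\<lambda>z. complex_of_real (m z))"
  proof -
    have "(\<Sum>t\<in>T. \<Phi> (\<lambda>z. complex_of_real (w t z)) * \<Phi> (\<lambda>z. complex_of_real (l t z))) =
        (\<Sum>t\<in>T. \<Phi> (\<lambda>z. complex_of_real (w t z) * complex_of_real (l t z)))"
      by (simp add: mult[OF wcc lcc])
    also have "\<dots> = \<Phi> (\<lambda>z. \<Sum>t\<in>T. complex_of_real (w t z) * complex_of_real (l t z))"
      by (rule sum[symmetric]) (use T wcc lcc in \<open>auto intro!: continuous_intros\<close>)
    finally show ?thesis by (simp add: m_def)
  qed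
  have "positive (\<Sum>t\<in>T. E (\<Phi> (\<lambda>z. complex_of_real (w t z)) * (x - \<Phi> (\<lambda>z. complex_of_real (l t z)))))"
    by (rule positive_sum[OF T(2)], rule positive_weighted_expectation[OF E aE wc w0])
       (simp_all add: la cd(2) TS)
  also have "(\<Sum>t\<in>T. E (\<Phi> (\<lambda>z. complex_of_real (w t z)) * (x - \<Phi> (\<lambda>z. complex_of_real (l t z))))) =
      E ((\<Sum>t\<in>T. \<Phi> (\<lambda>z. complex_of_real (w t z))) * x -
         (\<Sum>t\<in>T. \<Phi> (\<lambda>z. complex_of_real (w t z)) * \<Phi> (\<lambda>z. complex_of_real (l t z))))"
    by (simp add: right_diff_distrib sum_distrib_right sum_subtractf clinear_rules[OF L])
  finally have 1: "positive (E x - E (\<Phi> (\<lambda>z. complex_of_real (m z))))"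
    by (simp add: sum_w sum_wl clinear_rules[OF L])
  have m_ge: "h (Re z) - e \<le> m z" if z: "z \<in> spectrum a" for z
  proof -
    have "(\<Sum>t\<in>T. w t z * (h (Re z) - e)) \<le> (\<Sum>t\<in>T. w t z * l t z)"
    proof (rule sum_mono)
      fix t assume "t \<in> T"
      show "w t z * (h (Re z) - e) \<le> w t z * l t z"
      proof (cases "u t z = 0")
        case False
        then have "h (Re z) - e \<le> l t z" by (auto simp: u_def max_def split: if_splits)
        then show ?thesis using w0[OF z] by (rule mult_left_mono)
      qed (simp add: w_def)
    qed
    then show ?thesis using w1[OF z] by (simp add: m_def flip: sum_distrib_right)
  qed
  have hcc: "continuous_on (spectrum a) (\<lambda>z. complex_of_real (h (Re z)))"
    using hc by (intro continuous_intros)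
  have ecc: "continuous_on (spectrum a) (\<lambda>z. complex_of_real e)" by (rule continuous_on_const)
  have "(complex_of_real (m z) - complex_of_real (h (Re z))) + complex_of_real e \<in> \<real> \<and>
      0 \<le> Re ((complex_of_real (m z) - complex_of_real (h (Re z))) + complex_of_real e)"
    if "z \<in> spectrum a" for z
    using m_ge[OF that] by simp
  then have "positive (\<Phi> (\<lambda>z. (complex_of_real (m z) - complex_of_real (h (Re z))) + complex_of_real e))"
    by (intro positive_fc continuous_on_add continuous_on_diff mc hcc ecc) blast
  then have "positive (\<Phi> (\<lambda>z. complex_of_real (m z)) - cfc h a + complex_of_real e *\<^sub>C 1)"
    by (simp only: add[OF continuous_on_diff[OF mc hcc] ecc] diff[OF mc hcc] const cfc_eq[OF S])
  from positive_add[OF 1 P[OF this]]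
  show "positive (E x - E (cfc h a) + complex_of_real e *\<^sub>C E 1)"
    by (simp add: clinear_rules[OF L] algebra_simps)
qed

end

lemma functional_calculus_exists:
  assumes "self_adjoint a"
  obtains \<Phi> where "functional_calculus a \<Phi>"
  using functional_calculus_hom_exists[OF assms] assms by (auto simp: functional_calculus_def)

lemma self_adjoint_cfc:
  assumes "self_adjoint a" "spectrum a \<subseteq> complex_of_real ` S" "continuous_on S f"
  shows "self_adjoint (cfc f a)" "spectrum (cfc f a) \<subseteq> complex_of_real ` f ` S"
proof -
  obtain \<Phi> where "functional_calculus a \<Phi>" by (rule functional_calculus_exists[OF assms(1)])
  then interpret functional_calculus a \<Phi> .
  note c = continuous_of_real_Re[OF assms(2,3)]
  show "self_adjoint (cfc f a)"
    unfolding cfc_eq[OF assms(2,3)] by (rule self_adjoint_real[OF c]) simp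
  show "spectrum (cfc f a) \<subseteq> complex_of_real ` f ` S"
    unfolding cfc_eq[OF assms(2,3)]
    by (rule order_trans[OF spectrum_subset[OF c]]) (use assms(2) in force)
qed

lemma cfc_cfc:
  assumes a: "self_adjoint a" "spectrum a \<subseteq> complex_of_real ` S" and f: "continuous_on S f"
    and g: "continuous_on J g" "f ` S \<subseteq> J"
  shows "cfc g (cfc f a) = cfc (\<lambda>s. g (f s)) a"
proof -
  obtain \<Phi> where "functional_calculus a \<Phi>" by (rule functional_calculus_exists[OF a(1)])
  then interpret A: functional_calculus a \<Phi> .
  obtain \<Psi> where "functional_calculus (cfc f a) \<Psi>"
    using functional_calculus_exists self_adjoint_cfc(1)[OF a f] by blast
  then interpret B: functional_calculus "cfc f a" \<Psi> .
  let ?h = "\<lambda>z. complex_of_real (f (Re z))"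
  have h: "continuous_on (spectrum a) ?h" by (rule A.continuous_of_real_Re[OF a(2) f])
  have fa: "cfc f a = \<Phi> ?h" by (rule A.cfc_eq[OF a(2) f])
  have sub: "?h ` spectrum a \<subseteq> complex_of_real ` J" using a(2) g(2) by force
  have "spectrum (cfc f a) \<subseteq> complex_of_real ` J"
    using self_adjoint_cfc(2)[OF a f] g(2) by blast
  then have "cfc g (cfc f a) = \<Psi> (\<lambda>z. complex_of_real (g (Re z)))"
    by (rule B.cfc_eq) (rule g(1))
  also have "\<dots> = \<Phi> (\<lambda>z. complex_of_real (g (Re (?h z))))"
  proof (rule A.compose[OF h])
    show "functional_calculus_hom (\<Phi> ?h) \<Psi>" using B.hom by (simp add: fa)
    have "Re ` ?h ` spectrum a \<subseteq> J" using sub by auto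
    then show "continuous_on (?h ` spectrum a) (\<lambda>z. complex_of_real (g (Re z)))"
      by (intro continuous_intros continuous_on_compose2[OF g(1)]) auto
  qed auto
  also have "\<dots> = cfc (\<lambda>s. g (f s)) a"
    using A.cfc_eq[OF a(2) continuous_on_compose2[OF g(1) f g(2)]] by simp
  finally show ?thesis .
qed

theorem theorem3p8:
  fixes \<phi> :: "'a::unital_cstar_algebra \<Rightarrow> 'b::unital_cstar_algebra"
    and E :: "'b \<Rightarrow> 'b" and C :: "'b set"
    and f g :: "real \<Rightarrow> real" and I J :: "real set" and a :: 'a
  assumes "positive_map \<phi>" and "\<phi> 1 = 1"
    and "cstar_subalgebra C" and "conditional_expectation E C"
    and "open I" and "is_interval I" and "convex_on I f"
    and "self_adjoint a" and "spectrum a \<subseteq> complex_of_real ` I"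
    and "\<phi> a \<in> centralizer E"
    and "open J" and "is_interval J" and "convex_on J g" and "mono_on J g"
    and "f ` I \<subseteq> J"
  shows "E (cfc g (cfc f (\<phi> a))) \<preceq> E (cfc g (\<phi> (cfc f a)))"
proof -
  define b where "b = \<phi> a"
  define y where "y = \<phi> (cfc f a)"
  have L: "clinear \<phi>" and P: "\<And>x. positive x \<Longrightarrow> positive (\<phi> x)"
    using assms(1) by (simp_all add: positive_map_def)
  have E: "positive_map E" "bounded_linear E"
    using assms(4) by (simp_all add: conditional_expectation_def)
  have fc: "continuous_on I f" and gc: "continuous_on J g"
    using assms by (auto intro: convex_on_continuous)
  have ghc: "continuous_on I (\<lambda>s. g (f s))"
    by (rule continuous_on_compose2[OF gc fc assms(15)])
  have b: "self_adjoint b" "spectrum b \<subseteq> complex_of_real ` I"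
    unfolding b_def
    by (rule positive_map_self_adjoint[OF assms(1,8)],
        rule spectrum_positive_unital_map[OF assms(1,2,8,6,9)])
  have fa: "self_adjoint (cfc f a)" "spectrum (cfc f a) \<subseteq> complex_of_real ` J"
    using self_adjoint_cfc[OF assms(8,9) fc] assms(15) by blast+
  have y: "self_adjoint y" "spectrum y \<subseteq> complex_of_real ` J"
    unfolding y_def
    by (rule positive_map_self_adjoint[OF assms(1) fa(1)],
        rule spectrum_positive_unital_map[OF assms(1,2) fa(1) assms(12) fa(2)])
  obtain \<Phi>\<^sub>a where "functional_calculus a \<Phi>\<^sub>a" by (rule functional_calculus_exists[OF assms(8)])
  then interpret A: functional_calculus a \<Phi>\<^sub>a .
  obtain \<Phi>\<^sub>b where "functional_calculus b \<Phi>\<^sub>b" by (rule functional_calculus_exists[OF b(1)])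
  then interpret B: functional_calculus b \<Phi>\<^sub>b .
  obtain \<Phi>\<^sub>y where "functional_calculus y \<Phi>\<^sub>y" by (rule functional_calculus_exists[OF y(1)])
  then interpret Y: functional_calculus y \<Phi>\<^sub>y .
  have "positive (E (cfc g y) - E (cfc (\<lambda>s. g (f s)) b))"
  proof (rule B.expectation_ge_cfc[OF E _ b(2) ghc])
    show "b \<in> centralizer E" using assms(10) by (simp add: b_def)
    fix t assume t: "t \<in> I"
    then have ft: "f t \<in> J" using assms(15) by blast
    obtain p where p: "\<And>s. s \<in> I \<Longrightarrow> f t + p * (s - t) \<le> f s"
      using convex_on_supporting_line[OF assms(5,7) t] by blast
    obtain q where q: "\<And>s. s \<in> J \<Longrightarrow> g (f t) + q * (s - f t) \<le> g s"
      using convex_on_supporting_line[OF assms(11,13) ft] by blast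
    have q0: "0 \<le> q" by (rule mono_supporting_slope_nonneg[OF assms(11,14) ft q])
    \<comment> \<open>\<open>p\<close> and \<open>q\<close> are the slopes of the supporting lines, \<open>p0\<close> and \<open>q0\<close> their intercepts\<close>
    define p0 where "p0 = f t - p * t"
    define q0 where "q0 = g (f t) - q * f t"
    have "positive (cfc f a - (complex_of_real p0 *\<^sub>C 1 + complex_of_real p *\<^sub>C a))"
      by (rule A.positive_cfc_minus_affine[OF assms(9) fc]) (use p in \<open>simp add: p0_def algebra_simps\<close>)
    then have "positive (\<phi> (cfc f a - (complex_of_real p0 *\<^sub>C 1 + complex_of_real p *\<^sub>C a)))" by (rule P)
    then have 1: "positive (y - (complex_of_real p0 *\<^sub>C 1 + complex_of_real p *\<^sub>C b))"
      by (simp add: clinear_rules[OF L] assms(2) y_def b_def)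
    have 2: "positive (cfc g y - (complex_of_real q0 *\<^sub>C 1 + complex_of_real q *\<^sub>C y))"
      by (rule Y.positive_cfc_minus_affine[OF y(2) gc]) (use q in \<open>simp add: q0_def algebra_simps\<close>)
    have "cfc g y - (complex_of_real (q0 + q * p0) *\<^sub>C 1 + complex_of_real (q * p) *\<^sub>C b) =
        (cfc g y - (complex_of_real q0 *\<^sub>C 1 + complex_of_real q *\<^sub>C y)) +
        complex_of_real q *\<^sub>C (y - (complex_of_real p0 *\<^sub>C 1 + complex_of_real p *\<^sub>C b))"
      by (simp add: cvs.scale_right_diff_distrib scaleC_add_right scaleC_add_left scaleC_scaleC)
    with positive_add[OF 2 positive_scaleC[OF 1 \<open>0 \<le> q\<close>]]
    have "positive (cfc g y - (complex_of_real (q0 + q * p0) *\<^sub>C 1 + complex_of_real (q * p) *\<^sub>C b))"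
      by (simp only:)
    moreover have "(q0 + q * p0) + (q * p) * t = g (f t)"
      by (simp add: q0_def p0_def algebra_simps)
    ultimately show "\<exists>c d. c + d * t = g (f t) \<and>
        positive (cfc g y - (complex_of_real c *\<^sub>C 1 + complex_of_real d *\<^sub>C b))" by blast
  qed
  then show ?thesis
    using cfc_cfc[OF b fc gc assms(15)] by (simp add: cstar_le_def b_def y_def)
qed

end
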